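(* Let $G$ be a group and $L,N$ normal subgroups with $L\geqslant N$. Assume $\mathcal{W}(G,L,N)$ is nonzero and finite dimensional, $\ell=\dim_{\mathbb{R}}\mathcal{W}(G,L,N)$. Take any basis of $\mathcal{W}(G,L,N)$ and representatives $\nu_1,\dots,\nu_\ell\in\mathrm{Q}(N)^G$, and let $Z=[G,N]\cap\bigcap_{j=1}^\ell\nu_j^{-1}(\{0\})$. Then there is a constant $C>0$ (depending on $\nu_1,\dots,\nu_\ell$) such that $\mathrm{scl}_{G,N}(z)\le C\cdot\mathrm{scl}_{G,L}(z)$ for every $z\in Z$; one may take $C=\mathscr{C}_1$, where $\mathscr{C}_1$ is any constant for which there is $\mathscr{C}_2>0$ such that every $\nu\in\mathrm{Q}(N)^G$ can be written as $\nu=k+\psi|_N+\sum_j a_j\nu_j$ with $k\in\mathrm{H}^1(N)^G$, $\psi\in\mathrm{Q}(L)^G$, $a_j\in\mathbb{R}$ and $\mathscr{D}(\nu)\ge\mathscr{C}_1^{-1}(\mathscr{D}(\psi)+\mathscr{C}_2^{-1}\sum_j|a_j|)$.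
   Context: $[G,N]$ is generated by $[g,x]=gxg^{-1}x^{-1}$ ($g\in G,x\in N$); $\mathrm{cl}_{G,N}$ word length w.r.t. these; $\mathrm{scl}_{G,N}(y)=\lim_n\mathrm{cl}_{G,N}(y^n)/n$, and similarly $\mathrm{scl}_{G,L}$. $\mathscr{D}$ is the defect $\sup|\psi(h_1h_2)-\psi(h_1)-\psi(h_2)|$. $\mathrm{Q}(N)^G$ (resp. $\mathrm{Q}(L)^G$): homogeneous quasimorphisms on $N$ (resp. $L$) invariant under $G$-conjugation; $\mathrm{H}^1(N)^G$: $G$-invariant homomorphisms $N\to\mathbb{R}$; $\mathcal{W}(G,L,N)=\mathrm{Q}(N)^G/(\mathrm{H}^1(N)^G+\{\psi|_N:\psi\in\mathrm{Q}(L)^G\})$. (Constants $\mathscr{C}_1,\mathscr{C}_2$ as described exist for any such choice of representatives.) *)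

theory Defs
  imports "HOL-Algebra.Algebra" Complex_Main
begin

definition mcomm :: "('a, 'b) monoid_scheme \<Rightarrow> 'a \<Rightarrow> 'a \<Rightarrow> 'a" where
  "mcomm G g x = g \<otimes>\<^bsub>G\<^esub> x \<otimes>\<^bsub>G\<^esub> inv\<^bsub>G\<^esub> g \<otimes>\<^bsub>G\<^esub> inv\<^bsub>G\<^esub> x"

definition comm_gens :: "('a, 'b) monoid_scheme \<Rightarrow> 'a set \<Rightarrow> 'a set" where
  "comm_gens G N = {mcomm G g x | g x. g \<in> carrier G \<and> x \<in> N}"

definition comm_subgroup :: "('a, 'b) monoid_scheme \<Rightarrow> 'a set \<Rightarrow> 'a set" where
  "comm_subgroup G N = generate G (comm_gens G N)"

definition cl :: "('a, 'b) monoid_scheme \<Rightarrow> 'a set \<Rightarrow> 'a \<Rightarrow> nat" where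
  "cl G N y = (LEAST n. \<exists>ws. length ws = n \<and>
      set ws \<subseteq> comm_gens G N \<union> (\<lambda>c. inv\<^bsub>G\<^esub> c) ` comm_gens G N \<and>
      foldr (\<lambda>a b. a \<otimes>\<^bsub>G\<^esub> b) ws \<one>\<^bsub>G\<^esub> = y)"

definition scl :: "('a, 'b) monoid_scheme \<Rightarrow> 'a set \<Rightarrow> 'a \<Rightarrow> real" where
  "scl G N y = lim (\<lambda>n::nat. real (cl G N (y [^]\<^bsub>G\<^esub> n)) / real n)"

definition defect :: "('a, 'b) monoid_scheme \<Rightarrow> 'a set \<Rightarrow> ('a \<Rightarrow> real) \<Rightarrow> real" where
  "defect G H \<psi> = (SUP p \<in> H \<times> H. \<bar>\<psi> (fst p \<otimes>\<^bsub>G\<^esub> snd p) - \<psi> (fst p) - \<psi> (snd p)\<bar>)"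

definition G_invariant :: "('a, 'b) monoid_scheme \<Rightarrow> 'a set \<Rightarrow> ('a \<Rightarrow> real) \<Rightarrow> bool" where
  "G_invariant G H \<psi> \<longleftrightarrow>
     (\<forall>g\<in>carrier G. \<forall>x\<in>H. \<psi> (g \<otimes>\<^bsub>G\<^esub> x \<otimes>\<^bsub>G\<^esub> inv\<^bsub>G\<^esub> g) = \<psi> x)"

definition hom_qm :: "('a, 'b) monoid_scheme \<Rightarrow> 'a set \<Rightarrow> ('a \<Rightarrow> real) \<Rightarrow> bool" where
  "hom_qm G H \<psi> \<longleftrightarrow>
     (\<exists>D. \<forall>a\<in>H. \<forall>b\<in>H. \<bar>\<psi> (a \<otimes>\<^bsub>G\<^esub> b) - \<psi> a - \<psi> b\<bar> \<le> D) \<and>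
     (\<forall>x\<in>H. \<forall>n::int. \<psi> (x [^]\<^bsub>G\<^esub> n) = of_int n * \<psi> x)"

definition QG :: "('a, 'b) monoid_scheme \<Rightarrow> 'a set \<Rightarrow> ('a \<Rightarrow> real) set" where
  "QG G H = {\<psi>. hom_qm G H \<psi> \<and> G_invariant G H \<psi>}"

definition H1G :: "('a, 'b) monoid_scheme \<Rightarrow> 'a set \<Rightarrow> ('a \<Rightarrow> real) set" where
  "H1G G H = {k. (\<forall>a\<in>H. \<forall>b\<in>H. k (a \<otimes>\<^bsub>G\<^esub> b) = k a + k b) \<and> G_invariant G H k}"

text \<open>nu_0,...,nu_(l-1) in Q(N)^G are representatives of a basis of
  W(G,L,N) = Q(N)^G / (H^1(N)^G + Q(L)^G|_N): their classes are linearly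
  independent and span W (functions compared on N).\<close>
definition W_basis_reps ::
  "('a, 'b) monoid_scheme \<Rightarrow> 'a set \<Rightarrow> 'a set \<Rightarrow> nat \<Rightarrow> (nat \<Rightarrow> 'a \<Rightarrow> real) \<Rightarrow> bool" where
  "W_basis_reps G L N l \<nu> \<longleftrightarrow>
     (\<forall>j<l. \<nu> j \<in> QG G N) \<and>
     (\<forall>a::nat \<Rightarrow> real.
        (\<exists>k\<in>H1G G N. \<exists>\<psi>\<in>QG G L. \<forall>x\<in>N. (\<Sum>j<l. a j * \<nu> j x) = k x + \<psi> x)
        \<longrightarrow> (\<forall>j<l. a j = 0)) \<and>
     (\<forall>\<mu>\<in>QG G N. \<exists>k\<in>H1G G N. \<exists>\<psi>\<in>QG G L. \<exists>a::nat \<Rightarrow> real.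
        \<forall>x\<in>N. \<mu> x = k x + \<psi> x + (\<Sum>j<l. a j * \<nu> j x))"

end

(* By Hahn-Banach, scl_{G,N} is attained: stable mixed commutator length extends to a seminorm P on
   rational chains on N, and a linear functional f with |f| <= P restricts to a G-invariant
   homogeneous quasimorphism x |-> f(x) of defect at most 1/2, because (ab)^m and a^m b^m differ by
   about m/2 commutators.  If mu = k + psi + sum_j a_j nu_j norms z in Z, then
   scl_{G,N}(z) = mu(z) = psi(z) <= 2 D(psi) scl_{G,L}(z), and the hypothesis on C_1 bounds D(psi)
   by C_1/2.  The existence of some constant needs no such C_1: every functional dominated by a
   multiple of P is bounded by a multiple of scl_{G,L} on Z, so the uniform boundedness principle
   applies. *)

theory Submission
  imports Defs "HOL-Library.Function_Algebras"
begin

section \<open>Sublinear functionals on abelian groups\<close>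

text \<open>A quasimorphism is not additive, so Hahn-Banach is applied to formal sums:
  \<open>ab - a - b\<close> is itself a chain, and its stable length controls the defect. The chains
  \<open>x^n - n x\<close> and \<open>g x g^-1 - x\<close> have stable length zero, which is why a
  dominated functional is exactly homogeneous and exactly invariant. A chain is realised in the
  group by multiplying powers in some order. Reordering costs a number of commutators that depends
  on the list but not on the exponents, and such bounded errors vanish in the limit. The constant
  comes out as \<open>C1\<close> because two factors cancel. A commutator costs a quasimorphism one
  defect for its own value and one for being multiplied in; this 2 meets the defect bound 1/2.
  Counting about m commutators instead of m/2 between \<open>(ab)^m\<close> and
  \<open>a^m b^m\<close> would give only \<open>2 C1\<close>.\<close>

lemma subadditive_quotient_convergent:
  fixes b :: "nat \<Rightarrow> real"
  assumes nonneg: "\<And>n. 0 \<le> b n" and sub: "\<And>m n. b (m + n) \<le> b m + b n"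
  shows "convergent (\<lambda>n. b n / real n)"
proof -
  \<comment> \<open>Fekete's lemma: the limit is this infimum. Index 0 is left out because
    \<open>b 0 / 0\<close> is 0 and would pull the infimum down to 0.\<close>
  define I where "I = (INF n\<in>{1..}. b n / real n)"
  have bdd: "bdd_below ((\<lambda>n. b n / real n) ` {1..})"
    by (rule bdd_belowI2[where m = 0]) (simp add: nonneg)
  have lower: "I \<le> b n / real n" if "n \<ge> 1" for n
    unfolding I_def using that by (intro cINF_lower[OF bdd]) simp
  have mult: "b (q * k + r) \<le> real q * b k + b r" for q k r
  proof (induction q)
    case (Suc q)
    have "b (Suc q * k + r) \<le> b k + b (q * k + r)"
      using sub[of k "q * k + r"] by (simp add: add.assoc)
    then show ?case using Suc by (simp add: algebra_simps)
  qed simp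
  have "(\<lambda>n. b n / real n) \<longlonglongrightarrow> I"
  proof (rule order_tendstoI)
    fix a assume "a < I"
    then show "\<forall>\<^sub>F n in sequentially. a < b n / real n"
      using lower by (intro eventually_sequentiallyI[of 1]) fastforce
  next
    fix a assume "I < a"
    then obtain k where k: "k \<ge> 1" "b k / real k < a"
      unfolding I_def using bdd by (subst (asm) cINF_less_iff) auto
    define B where "B = (\<Sum>r<k. b r)"
    have B: "b r \<le> B" if "r < k" for r
      unfolding B_def using that nonneg by (intro member_le_sum) auto
    have "(\<lambda>n. b k / real k + B / real n) \<longlonglongrightarrow> b k / real k + 0"
      by (intro tendsto_intros lim_const_over_n)
    then have "\<forall>\<^sub>F n in sequentially. b k / real k + B / real n < a"
      using k(2) by (auto dest: order_tendstoD(2))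
    then show "\<forall>\<^sub>F n in sequentially. b n / real n < a"
      using eventually_ge_at_top[of 1]
    proof eventually_elim
      case (elim n)
      have "b n \<le> real (n div k) * b k + b (n mod k)"
        using mult[of "n div k" k "n mod k"] by simp
      also have "\<dots> \<le> real n / real k * b k + B"
        using k(1) nonneg by (intro add_mono mult_right_mono of_nat_div_le_of_nat B) auto
      finally have "b n / real n \<le> (real n / real k * b k + B) / real n"
        by (rule divide_right_mono) simp
      also have "\<dots> = b k / real k + B / real n"
        using elim(2) by (simp add: add_divide_distrib)
      finally show ?case using elim(1) by linarith
    qed
  qed
  then show ?thesis by (rule convergentI)
qed

text \<open>Adding \<open>c\<close> to every term absorbs the error into genuine subadditivity, and
  \<open>c / n\<close> tends to 0.\<close>

lemma almost_subadditive_quotient_convergent: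
  fixes a :: "nat \<Rightarrow> real"
  assumes "\<And>n. 0 \<le> a n" and "\<And>m n. a (m + n) \<le> a m + a n + c" and "0 \<le> c"
  shows "convergent (\<lambda>n. a n / real n)"
proof -
  have "convergent (\<lambda>n. (a n + c) / real n)"
    using assms by (intro subadditive_quotient_convergent) (auto simp: algebra_simps)
  then obtain x where "(\<lambda>n. (a n + c) / real n) \<longlonglongrightarrow> x" by (auto simp: convergent_def)
  from tendsto_diff[OF this lim_const_over_n[of c]]
  have "(\<lambda>n. a n / real n) \<longlonglongrightarrow> x" by (simp add: add_divide_distrib)
  then show ?thesis by (rule convergentI)
qed

text \<open>Doubling replaces positive homogeneity, so the notion makes sense in any abelian group
  and Hahn-Banach yields additive functionals, which is all that is used later.\<close>

definition sublin :: "('v::ab_group_add \<Rightarrow> real) \<Rightarrow> bool" where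
  "sublin q \<longleftrightarrow> (\<forall>x y. q (x + y) \<le> q x + q y) \<and> (\<forall>x. q (x + x) = 2 * q x)"

lemma sublin_zero: "sublin q \<Longrightarrow> q 0 = 0"
  unfolding sublin_def by (metis add.right_neutral mult_2 add_left_cancel)

text \<open>This pointwise lower bound depends only on \<open>P\<close>, so infima over families
  dominated by \<open>P\<close> are finite.\<close>

lemma sublin_lower:
  assumes "sublin q" "\<And>x. q x \<le> P x"
  shows "- P (- x) \<le> q x"
proof -
  have "q (x + - x) \<le> q x + q (- x)" using assms(1) unfolding sublin_def by blast
  then show ?thesis using sublin_zero[OF assms(1)] assms(2)[of "- x"] by simp
qed

text \<open>The usual lowering \<open>inf_t (q (y + t x) - t q x)\<close> from Hahn-Banach, with
  \<open>t\<close> running through powers of two so that doubling suffices. Taking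
  \<open>y = - x\<close> in the second bound gives \<open>q' (- x) \<le> - q x\<close>: below
  \<open>q'\<close> an additive functional cannot be smaller than \<open>q x\<close> at
  \<open>x\<close>.\<close>

lemma sublin_descent:
  fixes q :: "'v::ab_group_add \<Rightarrow> real"
  assumes q: "sublin q"
  shows "\<exists>q'. sublin q' \<and> (\<forall>y. q' y \<le> q y) \<and> (\<forall>y. q' y \<le> q (y + x) - q x)"
proof -
  define D where "D k = ((\<lambda>v. v + v) ^^ k) x" for k
  have D_0: "D 0 = x" and D_Suc: "D (Suc k) = D k + D k" for k
    by (simp_all add: D_def)
  have q_add: "q (u + v) \<le> q u + q v" and q_dbl: "q (u + u) = 2 * q u" for u v
    using q by (auto simp: sublin_def)
  have q_D: "q (D k) = 2 ^ k * q x" for k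
    by (induction k) (simp_all add: D_0 D_Suc q_dbl)
  define r where "r y k = q (y + D k) - 2 ^ k * q x" for y k
  have "r y (Suc k) \<le> r y k" for y k
    using q_add[of "y + D k" "D k"] by (simp add: r_def D_Suc q_D algebra_simps)
  then have dec: "decseq (r y)" for y by (intro decseq_SucI)
  have low: "- q (- y) \<le> r y k" for y k
    using q_add[of "- y" "y + D k"] by (simp add: r_def q_D)
  define q' where "q' y = lim (r y)" for y
  have lim: "r y \<longlonglongrightarrow> q' y" for y
  proof -
    have "\<forall>k. - q (- y) \<le> r y k" using low by simp
    then obtain L where "r y \<longlonglongrightarrow> L" using decseq_convergent[OF dec[of y]] by metis
    then show ?thesis unfolding q'_def by (simp add: limI)
  qed
  have le: "q' y \<le> r y k" for y k
    using decseq_ge[OF dec lim] .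
  \<comment> \<open>\<open>D (Suc k)\<close> is split into one copy of \<open>D k\<close> for
    \<open>y\<close> and one for \<open>z\<close>; hence the shifted index on the left.\<close>
  have "q' (y + z) \<le> q' y + q' z" for y z
  proof (rule LIMSEQ_le[OF LIMSEQ_Suc[OF lim] tendsto_add[OF lim lim]], intro exI allI impI)
    fix k
    have "q ((y + z) + D (Suc k)) \<le> q (y + D k) + q (z + D k)"
      using q_add[of "y + D k" "z + D k"] by (simp add: D_Suc algebra_simps)
    then show "r (y + z) (Suc k) \<le> r y k + r z k" by (simp add: r_def)
  qed
  moreover have "q' (y + y) = 2 * q' y" for y
  proof (rule LIMSEQ_unique[OF LIMSEQ_Suc[OF lim]])
    have "r (y + y) (Suc k) = 2 * r y k" for k
      using q_dbl[of "y + D k"] by (simp add: r_def D_Suc algebra_simps)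
    then show "(\<lambda>k. r (y + y) (Suc k)) \<longlonglongrightarrow> 2 * q' y"
      using tendsto_mult_left[OF lim] by simp
  qed
  ultimately have "sublin q'" by (simp add: sublin_def)
  moreover have "q' y \<le> q (y + x) - q x" for y
    using le[of y 0] by (simp add: r_def D_0)
  moreover from this have "q' y \<le> q y" for y
    using q_add[of y x] by (smt (verit))
  ultimately show ?thesis by blast
qed

text \<open>Supplies the lower bounds for Zorn. Subadditivity is where comparability enters: of a
  \<open>q\<close> used at \<open>x\<close> and an \<open>r\<close> used at \<open>y\<close>, the
  smaller one serves at both points.\<close>

lemma sublin_chain_Inf:
  fixes C :: "('v::ab_group_add \<Rightarrow> real) set"
  assumes "C \<noteq> {}" and sub: "\<And>q. q \<in> C \<Longrightarrow> sublin q" and le: "\<And>q x. q \<in> C \<Longrightarrow> q x \<le> P x"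
    and chain: "\<And>q r. q \<in> C \<Longrightarrow> r \<in> C \<Longrightarrow> q \<le> r \<or> r \<le> q"
  shows "sublin (\<lambda>x. INF q\<in>C. q x) \<and> (\<forall>r\<in>C. (\<lambda>x. INF q\<in>C. q x) \<le> r)"
proof -
  have bdd: "bdd_below ((\<lambda>q. q x) ` C)" for x
    using sublin_lower[OF sub] le by (intro bdd_belowI2[where m = "- P (- x)"]) blast
  have lower: "(INF q\<in>C. q x) \<le> r x" if "r \<in> C" for r x
    by (rule cINF_lower[OF bdd that])
  have "(INF q\<in>C. q (x + y)) \<le> (INF q\<in>C. q x) + (INF q\<in>C. q y)" for x y
  proof -
    have "(INF q\<in>C. q (x + y)) \<le> q x + r y" if qr: "q \<in> C" "r \<in> C" for q r
    proof -
      obtain s where s: "s \<in> C" "s \<le> q" "s \<le> r" using chain qr by blast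
      have "(INF q\<in>C. q (x + y)) \<le> s x + s y"
        using lower[OF s(1), of "x + y"] sub[OF s(1)] unfolding sublin_def by (smt (verit))
      then show ?thesis using s(2,3) by (smt (verit) le_funD)
    qed
    then have "(INF q\<in>C. q (x + y)) - r y \<le> (INF q\<in>C. q x)" if "r \<in> C" for r
      using that by (intro cINF_greatest[OF assms(1)]) (smt (verit))
    then have "(INF q\<in>C. q (x + y)) - (INF q\<in>C. q x) \<le> (INF q\<in>C. q y)"
      by (intro cINF_greatest[OF assms(1)]) (smt (verit))
    then show ?thesis by simp
  qed
  moreover have "(INF q\<in>C. q (x + x)) = 2 * (INF q\<in>C. q x)" for x
  proof (rule antisym)
    have "(INF q\<in>C. q (x + x)) / 2 \<le> q x" if "q \<in> C" for q
      using lower[OF that, of "x + x"] sub[OF that] unfolding sublin_def by (smt (verit) field_sum_of_halves)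
    then have "(INF q\<in>C. q (x + x)) / 2 \<le> (INF q\<in>C. q x)"
      by (intro cINF_greatest[OF assms(1)])
    then show "(INF q\<in>C. q (x + x)) \<le> 2 * (INF q\<in>C. q x)" by simp
    have "2 * (INF q\<in>C. q x) \<le> q (x + x)" if "q \<in> C" for q
      using lower[OF that, of x] sub[OF that] unfolding sublin_def by simp
    then show "2 * (INF q\<in>C. q x) \<le> (INF q\<in>C. q (x + x))"
      by (intro cINF_greatest[OF assms(1)])
  qed
  ultimately show ?thesis using lower by (simp add: sublin_def le_fun_def)
qed

text \<open>A minimal sublinear functional is additive, since \<open>sublin_descent\<close> cannot lower it.\<close>

lemma sublin_dominates_additive:
  fixes P :: "'v::ab_group_add \<Rightarrow> real"
  assumes P: "sublin P"
  shows "\<exists>f. (\<forall>x y. f (x + y) = f x + f y) \<and> (\<forall>x. f x \<le> P x)"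
proof -
  define A where "A = {q. sublin q \<and> q \<le> P}"
  have "\<exists>m\<in>A. \<forall>q\<in>A. q \<le> m \<longrightarrow> q = m"
  proof (rule predicate_Zorn)
    show "partial_order_on A (relation_of (\<lambda>q r. r \<le> q) A)"
      by (rule partial_order_on_relation_ofI) auto
  next
    fix C assume C: "C \<in> Chains (relation_of (\<lambda>q r. r \<le> q) A)"
    show "\<exists>u\<in>A. \<forall>a\<in>C. u \<le> a"
    proof (cases "C = {}")
      case True
      then show ?thesis using P by (auto simp: A_def)
    next
      case False
      then obtain r where r: "r \<in> C" by blast
      have sub: "C \<subseteq> A" using C by (auto simp: Chains_def relation_of_def)
      have "sublin (\<lambda>x. INF q\<in>C. q x) \<and> (\<forall>r\<in>C. (\<lambda>x. INF q\<in>C. q x) \<le> r)"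
        using C sub False
        by (intro sublin_chain_Inf[where P = P]) (auto simp: Chains_def relation_of_def A_def le_fun_def)
      moreover from this have "(\<lambda>x. INF q\<in>C. q x) \<le> P"
        using r sub by (metis (mono_tags, lifting) A_def mem_Collect_eq order_trans subsetD)
      ultimately show ?thesis by (auto simp: A_def)
    qed
  qed
  then obtain m where m: "sublin m" "m \<le> P" and min: "\<And>q. sublin q \<Longrightarrow> q \<le> m \<Longrightarrow> q = m"
    unfolding A_def by (metis (mono_tags, lifting) mem_Collect_eq order_trans)
  have "m (y + x) = m y + m x" for x y
  proof -
    obtain q' where "sublin q'" "\<forall>y. q' y \<le> m y" and le: "\<forall>y. q' y \<le> m (y + x) - m x"
      using sublin_descent[OF m(1)] by blast
    then have "q' = m" by (intro min) (auto simp: le_fun_def)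
    then show ?thesis using le m(1) unfolding sublin_def by (metis add.commute antisym le_diff_eq)
  qed
  then show ?thesis using m(2) by (auto simp: le_fun_def)
qed

text \<open>One descent in the direction \<open>v\<close>, before any additive minorant is chosen,
  forces \<open>f (- v) \<le> - P v\<close>.\<close>

lemma sublin_norming_additive:
  fixes P :: "'v::ab_group_add \<Rightarrow> real"
  assumes P: "sublin P"
  shows "\<exists>f. (\<forall>x y. f (x + y) = f x + f y) \<and> (\<forall>x. f x \<le> P x) \<and> f v = P v"
proof -
  obtain q where q: "sublin q" "\<forall>y. q y \<le> P y" "\<forall>y. q y \<le> P (y + v) - P v"
    using sublin_descent[OF P] by blast
  obtain f where f: "\<forall>x y. f (x + y) = f x + f y" "\<forall>x. f x \<le> q x"
    using sublin_dominates_additive[OF q(1)] by blast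
  have f0: "f 0 = 0" using f(1) by (metis add.right_neutral add_left_cancel)
  have "f (- v) + f v = 0" using f(1) f0 by (metis add.left_inverse)
  moreover have "f (- v) \<le> - P v"
    using f(2) q(3) sublin_zero[OF P] by (metis add.left_inverse diff_0 order_trans)
  moreover have le: "\<forall>x. f x \<le> P x" using f(2) q(2) order_trans by blast
  ultimately have "f v = P v" by (smt (verit))
  then show ?thesis using f(1) le by blast
qed

text \<open>Sokal's gliding hump: in the sum of the \<open>3\<^sup>-\<^sup>n g\<^sub>n\<close>, each sign is chosen so that the
  partial sum does not lose mass at \<open>v\<^sub>n\<close>; the tail is then too small to cancel it.\<close>

lemma weakly_bounded_imp_bounded:
  fixes P :: "'v::ab_group_add \<Rightarrow> real" and e :: "'i \<Rightarrow> 'v" and w :: "'i \<Rightarrow> real"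
  assumes P: "sublin P" and sym: "\<And>v. P (- v) = P v" and w: "\<And>i. i \<in> E \<Longrightarrow> 0 \<le> w i"
    and weak: "\<And>f K. 0 \<le> K \<Longrightarrow> (\<And>x y. f (x + y) = f x + f y) \<Longrightarrow> (\<And>x. \<bar>f x\<bar> \<le> K * P x) \<Longrightarrow>
      \<exists>B. \<forall>i\<in>E. \<bar>f (e i)\<bar> \<le> B * w i"
  shows "\<exists>C>0. \<forall>i\<in>E. P (e i) \<le> C * w i"
proof (rule ccontr)
  assume "\<not> ?thesis"
  \<comment> \<open>The base 4 beats the weights \<open>3^-n\<close> used below: their product
    \<open>(4/3)^n\<close> is unbounded.\<close>
  then have "\<exists>i\<in>E. 4 ^ n * w i < P (e i)" for n :: nat
    by (metis not_le zero_less_numeral zero_less_power)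
  then obtain i where i: "\<And>n. i n \<in> E" "\<And>n::nat. 4 ^ n * w (i n) < P (e (i n))" by metis
  define v where "v n = e (i n)" for n
  have v: "4 ^ n * w (i n) < P (v n)" for n using i(2) by (simp add: v_def)
  have "\<exists>g. (\<forall>x y. g (x + y) = g x + g y) \<and> (\<forall>x. g x \<le> P x) \<and> g (v n) = P (v n)" for n
    by (rule sublin_norming_additive[OF P])
  then obtain g where g_add: "\<And>n x y. g n (x + y) = g n x + g n y"
    and g_le: "\<And>n x. g n x \<le> P x" and g_v: "\<And>n. g n (v n) = P (v n)" by metis
  have P_nonneg: "0 \<le> P x" for x
    using sublin_lower[OF P, of P x] sym[of x] by simp
  have g_abs: "\<bar>g n x\<bar> \<le> P x" for n x
  proof -
    have "g n 0 = 0" using g_add[of n 0 0] by simp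
    then have "g n x + g n (- x) = 0" using g_add[of n x "- x"] by simp
    then show ?thesis using g_le[of n x] g_le[of n "- x"] sym[of x] by linarith
  qed
  define t where "t n = (1 / 3 :: real) ^ n" for n
  define S where "S = rec_nat (\<lambda>_. 0) (\<lambda>n h x. h x + (if 0 \<le> h (v n) then 1 else - 1) * t n * g n x)"
  have S_0: "S 0 x = 0"
    and S_Suc: "S (Suc n) x = S n x + (if 0 \<le> S n (v n) then 1 else - 1) * t n * g n x" for n x
    by (simp_all add: S_def)
  have t_pos: "0 < t n" for n by (simp add: t_def)
  have S_add: "S n (x + y) = S n x + S n y" for n x y
    by (induction n) (simp_all add: S_0 S_Suc g_add algebra_simps)
  have step: "\<bar>S (Suc n) x - S n x\<bar> \<le> t n * P x" for n x
    using mult_left_mono[OF g_abs[of n x], of "t n"] t_pos[of n]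
    by (simp add: S_Suc abs_mult)
  \<comment> \<open>Geometric series with ratio 1/3 and sum 3/2, kept in telescoped form so that the
    induction closes.\<close>
  have dist: "\<bar>S (n + k) x - S n x\<bar> \<le> (3 / 2 * t n - 3 / 2 * t (n + k)) * P x" for n k x
  proof (induction k)
    case (Suc k)
    have "\<bar>S (n + Suc k) x - S n x\<bar> \<le> (3 / 2 * t n - 3 / 2 * t (n + k)) * P x + t (n + k) * P x"
      using Suc step[of "n + k" x] by simp
    also have "\<dots> = (3 / 2 * t n - 3 / 2 * t (n + Suc k)) * P x"
      by (simp add: t_def algebra_simps)
    finally show ?case .
  qed simp
  have dist': "\<bar>S m x - S n x\<bar> \<le> 3 / 2 * t n * P x" if "n \<le> m" for m n x
  proof -
    have "\<bar>S m x - S n x\<bar> \<le> (3 / 2 * t n - 3 / 2 * t m) * P x"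
      using dist[of n "m - n" x] that by simp
    also have "\<dots> \<le> 3 / 2 * t n * P x"
      using P_nonneg[of x] t_pos[of m] by (intro mult_right_mono) auto
    finally show ?thesis .
  qed
  have t_lim: "t \<longlonglongrightarrow> 0"
    unfolding t_def by (intro LIMSEQ_realpow_zero) auto
  have "Cauchy (\<lambda>n. S n x)" for x
  proof (rule metric_CauchyI)
    fix e :: real assume "0 < e"
    have "(\<lambda>n. 3 / 2 * t n * P x) \<longlonglongrightarrow> 3 / 2 * 0 * P x"
      by (intro tendsto_intros t_lim)
    moreover have "3 / 2 * 0 * P x < e / 2" using \<open>0 < e\<close> by simp
    ultimately have "\<forall>\<^sub>F n in sequentially. 3 / 2 * t n * P x < e / 2"
      by (rule order_tendstoD(2))
    then obtain M where M: "3 / 2 * t M * P x < e / 2" by (auto simp: eventually_sequentially)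
    show "\<exists>M. \<forall>m\<ge>M. \<forall>n\<ge>M. dist (S m x) (S n x) < e"
    proof (intro exI allI impI)
      fix m n assume "M \<le> m" "M \<le> n"
      then show "dist (S m x) (S n x) < e"
        using dist'[of M m x] dist'[of M n x] M unfolding dist_real_def by linarith
    qed
  qed
  then have conv: "(\<lambda>n. S n x) \<longlonglongrightarrow> lim (\<lambda>n. S n x)" for x
    by (simp add: Cauchy_convergent_iff convergent_LIMSEQ_iff)
  define f where "f x = lim (\<lambda>n. S n x)" for x
  have f_add: "f (x + y) = f x + f y" for x y
    using LIMSEQ_unique[OF conv[of "x + y"]] tendsto_add[OF conv[of x] conv[of y]]
    by (simp add: f_def S_add)
  have tail: "\<bar>f x - S n x\<bar> \<le> 3 / 2 * t n * P x" for n x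
  proof (rule LIMSEQ_le_const2)
    show "(\<lambda>m. \<bar>S m x - S n x\<bar>) \<longlonglongrightarrow> \<bar>f x - S n x\<bar>"
      unfolding f_def by (intro tendsto_intros conv)
    show "\<exists>N. \<forall>m\<ge>N. \<bar>S m x - S n x\<bar> \<le> 3 / 2 * t n * P x" using dist' by blast
  qed
  obtain B where B: "\<forall>j\<in>E. \<bar>f (e j)\<bar> \<le> B * w j"
    using weak[of "3 / 2" f] f_add tail[of _ 0] by (auto simp: S_0 t_def)
  \<comment> \<open>Stage \<open>n\<close> leaves mass at least \<open>t n * P (v n)\<close> at
    \<open>v n\<close>, while the tail from \<open>Suc n\<close> on removes at most half of
    it.\<close>
  have hump: "t n * P (v n) \<le> 2 * \<bar>f (v n)\<bar>" for n
  proof -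
    have "t n * P (v n) \<le> \<bar>S (Suc n) (v n)\<bar>"
      using t_pos[of n] P_nonneg[of "v n"] by (auto simp: S_Suc g_v abs_if)
    moreover have "3 / 2 * t (Suc n) = t n / 2" by (simp add: t_def)
    ultimately show ?thesis using tail[of "v n" "Suc n"] by (simp add: abs_if split: if_splits)
  qed
  have key: "(4 / 3) ^ n * w (i n) < 2 * B * w (i n)" for n
  proof -
    have "(4 / 3) ^ n * w (i n) = t n * (4 ^ n * w (i n))"
      by (simp add: t_def power_divide)
    also have "\<dots> < t n * P (v n)" using v t_pos by simp
    also have "\<dots> \<le> 2 * \<bar>f (v n)\<bar>" by (rule hump)
    also have "\<dots> \<le> 2 * (B * w (i n))" using B i(1) by (simp add: v_def)
    finally show ?thesis by simp
  qed
  obtain n where "2 * B < (4 / 3 :: real) ^ n"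
    using real_arch_pow[of "4 / 3" "2 * B"] by auto
  then show False
    using key[of n] w[OF i(1)[of n]] mult_right_mono[of "2 * B" "(4 / 3) ^ n" "w (i n)"] by linarith
qed

section \<open>Mixed commutator length\<close>

context normal
begin

lemma inv_cancel:
  assumes "x \<in> carrier G" "y \<in> carrier G"
  shows "inv x \<otimes> (x \<otimes> y) = y" "x \<otimes> (inv x \<otimes> y) = y"
  using assms by (simp_all add: m_assoc[symmetric])

text \<open>Products of at most \<open>n\<close> generators or inverses. A bound on
  \<open>cl\<close> alone says nothing about membership in [G,H], since \<open>LEAST\<close> of an
  unsatisfiable predicate is arbitrary; this predicate carries membership and length
  together.\<close>

inductive comm_ball :: "nat \<Rightarrow> 'a \<Rightarrow> bool" where
  comm_ball_one: "comm_ball n \<one>"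
| comm_ball_gen: "g \<in> carrier G \<Longrightarrow> x \<in> H \<Longrightarrow> comm_ball n y \<Longrightarrow> comm_ball (Suc n) (mcomm G g x \<otimes> y)"
| comm_ball_inv_gen: "g \<in> carrier G \<Longrightarrow> x \<in> H \<Longrightarrow> comm_ball n y \<Longrightarrow>
    comm_ball (Suc n) (inv (mcomm G g x) \<otimes> y)"

lemma conj_mem: "g \<in> carrier G \<Longrightarrow> x \<in> H \<Longrightarrow> g \<otimes> x \<otimes> inv g \<in> H"
  using inv_op_closed2 by simp

lemma mcomm_mem [simp]: "g \<in> carrier G \<Longrightarrow> x \<in> H \<Longrightarrow> mcomm G g x \<in> H"
  unfolding mcomm_def using conj_mem by auto

lemma mcomm_carrier: "g \<in> carrier G \<Longrightarrow> x \<in> H \<Longrightarrow> mcomm G g x \<in> carrier G"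
  by simp

lemma comm_ball_mem: "comm_ball n y \<Longrightarrow> y \<in> H"
  by (induction rule: comm_ball.induct) auto

lemma comm_ball_carrier: "comm_ball n y \<Longrightarrow> y \<in> carrier G"
  using comm_ball_mem by auto

lemma comm_ball_mult:
  assumes "comm_ball m x" "comm_ball n y"
  shows "comm_ball (m + n) (x \<otimes> y)"
  using assms
proof (induction rule: comm_ball.induct)
  case (comm_ball_one m)
  have "comm_ball n y \<Longrightarrow> comm_ball (m + n) y" for m n y
    by (rotate_tac, induction rule: comm_ball.induct) (auto intro: comm_ball.intros)
  then show ?case using comm_ball_one comm_ball_carrier by auto
next
  case (comm_ball_gen g x n z)
  then show ?case
    using comm_ball.comm_ball_gen[of g x] comm_ball_carrier[of _ y] comm_ball_carrier[of _ z]
    by (simp add: m_assoc mcomm_carrier)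
next
  case (comm_ball_inv_gen g x n z)
  then show ?case
    using comm_ball.comm_ball_inv_gen[of g x] comm_ball_carrier[of _ y] comm_ball_carrier[of _ z]
    by (simp add: m_assoc mcomm_carrier)
qed

lemma comm_ball_mono: "comm_ball m x \<Longrightarrow> m \<le> n \<Longrightarrow> comm_ball n x"
  using comm_ball_mult[OF comm_ball_one[of "n - m"], of m x] comm_ball_carrier by auto

lemma comm_ball_mcomm: "g \<in> carrier G \<Longrightarrow> x \<in> H \<Longrightarrow> comm_ball 1 (mcomm G g x)"
  using comm_ball_gen[OF _ _ comm_ball_one[of 0], of g x] by (simp add: mcomm_carrier)

lemma comm_ball_inv_mcomm: "g \<in> carrier G \<Longrightarrow> x \<in> H \<Longrightarrow> comm_ball 1 (inv (mcomm G g x))"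
  using comm_ball_inv_gen[OF _ _ comm_ball_one[of 0], of g x] by (simp add: mcomm_carrier)

lemma comm_ball_inv: "comm_ball n x \<Longrightarrow> comm_ball n (inv x)"
proof (induction rule: comm_ball.induct)
  case (comm_ball_one n)
  then show ?case by (simp add: comm_ball.comm_ball_one)
next
  case (comm_ball_gen g x n y)
  then show ?case
    using comm_ball_mult[OF comm_ball_gen.IH comm_ball_inv_mcomm[of g x]] comm_ball_carrier[of n y]
    by (simp add: inv_mult_group mcomm_carrier)
next
  case (comm_ball_inv_gen g x n y)
  then show ?case
    using comm_ball_mult[OF comm_ball_inv_gen.IH comm_ball_mcomm[of g x]] comm_ball_carrier[of n y]
    by (simp add: inv_mult_group mcomm_carrier)
qed

lemma conj_mult:
  assumes "g \<in> carrier G" "x \<in> carrier G" "y \<in> carrier G"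
  shows "g \<otimes> (x \<otimes> y) \<otimes> inv g = (g \<otimes> x \<otimes> inv g) \<otimes> (g \<otimes> y \<otimes> inv g)"
  using assms by (simp add: m_assoc inv_cancel)

lemma inv_conj:
  assumes "g \<in> carrier G" "x \<in> carrier G"
  shows "inv (g \<otimes> x \<otimes> inv g) = g \<otimes> inv x \<otimes> inv g"
  using assms by (simp add: m_assoc inv_mult_group)

lemma conj_mcomm:
  assumes "h \<in> carrier G" "g \<in> carrier G" "x \<in> carrier G"
  shows "h \<otimes> mcomm G g x \<otimes> inv h = mcomm G (h \<otimes> g \<otimes> inv h) (h \<otimes> x \<otimes> inv h)"
  unfolding mcomm_def using assms by (simp add: conj_mult inv_conj)

lemma comm_ball_conj:
  assumes "comm_ball n x" "g \<in> carrier G"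
  shows "comm_ball n (g \<otimes> x \<otimes> inv g)"
  using assms
proof (induction rule: comm_ball.induct)
  case (comm_ball_one n)
  then show ?case by (simp add: comm_ball.comm_ball_one)
next
  case (comm_ball_gen h x n y)
  then show ?case
    using comm_ball.comm_ball_gen[of "g \<otimes> h \<otimes> inv g" "g \<otimes> x \<otimes> inv g"] comm_ball_carrier[of n y]
    by (simp add: conj_mult conj_mcomm mcomm_carrier conj_mem)
next
  case (comm_ball_inv_gen h x n y)
  have "g \<otimes> inv (mcomm G h x) \<otimes> inv g = inv (mcomm G (g \<otimes> h \<otimes> inv g) (g \<otimes> x \<otimes> inv g))"
    using comm_ball_inv_gen by (simp add: conj_mcomm[symmetric] inv_conj mcomm_carrier)
  then show ?case
    using comm_ball_inv_gen comm_ball.comm_ball_inv_gen[of "g \<otimes> h \<otimes> inv g" "g \<otimes> x \<otimes> inv g"]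
      comm_ball_carrier[of n y]
    by (simp add: conj_mult mcomm_carrier conj_mem)
qed

lemma comm_ball_conj_iff:
  assumes "x \<in> carrier G" "g \<in> carrier G"
  shows "comm_ball n (g \<otimes> x \<otimes> inv g) \<longleftrightarrow> comm_ball n x"
proof
  assume "comm_ball n (g \<otimes> x \<otimes> inv g)"
  from comm_ball_conj[OF this, of "inv g"] show "comm_ball n x"
    using assms by (simp add: m_assoc inv_cancel)
qed (use assms comm_ball_conj in simp)

text \<open>The two products are conjugate by \<open>x\<close>, so words may be rotated cyclically
  at no cost.\<close>

lemma comm_ball_rotate:
  assumes "x \<in> carrier G" "y \<in> carrier G"
  shows "comm_ball n (x \<otimes> y) \<longleftrightarrow> comm_ball n (y \<otimes> x)"
  using comm_ball_conj_iff[of "y \<otimes> x" x n] assms by (simp add: m_assoc)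

lemma comm_ball_words:
  "comm_ball n y \<longleftrightarrow> (\<exists>ws. length ws \<le> n \<and>
      set ws \<subseteq> comm_gens G H \<union> (\<lambda>c. inv c) ` comm_gens G H \<and> foldr (\<lambda>a b. a \<otimes> b) ws \<one> = y)"
  (is "_ \<longleftrightarrow> (\<exists>ws. ?W n y ws)")
proof
  assume "comm_ball n y"
  then show "\<exists>ws. ?W n y ws"
  proof (induction rule: comm_ball.induct)
    case (comm_ball_one n)
    then show ?case by (intro exI[of _ "[]"]) simp
  next
    case (comm_ball_gen g x n y)
    then obtain ws where "?W n y ws" by blast
    then show ?case using comm_ball_gen.hyps
      by (intro exI[of _ "mcomm G g x # ws"]) (auto simp: comm_gens_def)
  next
    case (comm_ball_inv_gen g x n y)
    then obtain ws where "?W n y ws" by blast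
    then show ?case using comm_ball_inv_gen.hyps
      by (intro exI[of _ "inv (mcomm G g x) # ws"]) (auto simp: comm_gens_def)
  qed
next
  have "?W n y ws \<Longrightarrow> comm_ball n y" for ws
  proof (induction ws arbitrary: n y)
    case Nil
    then show ?case by (auto intro: comm_ball_one)
  next
    case (Cons a ws)
    from Cons.prems have "0 < n" by (cases n) auto
    then obtain k where k: "n = Suc k" using gr0_conv_Suc by blast
    have "comm_ball k (foldr (\<lambda>a b. a \<otimes> b) ws \<one>)"
      using Cons.prems k by (intro Cons.IH) auto
    then show ?case
      using Cons.prems k by (auto simp: comm_gens_def intro: comm_ball_gen comm_ball_inv_gen)
  qed
  then show "\<exists>ws. ?W n y ws \<Longrightarrow> comm_ball n y" by blast
qed

lemma cl_le:
  assumes "comm_ball n y" shows "cl G H y \<le> n"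
proof -
  obtain ws where ws: "length ws \<le> n" "set ws \<subseteq> comm_gens G H \<union> (\<lambda>c. inv c) ` comm_gens G H"
    "foldr (\<lambda>a b. a \<otimes> b) ws \<one> = y"
    using assms comm_ball_words[of n y] by auto
  have "cl G H y \<le> length ws"
    unfolding cl_def by (rule Least_le) (use ws(2,3) in \<open>intro exI[of _ ws] conjI refl\<close>)
  then show ?thesis using ws(1) by simp
qed

lemma comm_ball_cl:
  assumes "comm_ball n y" shows "comm_ball (cl G H y) y"
proof -
  define Q where "Q k \<longleftrightarrow> (\<exists>ws. length ws = k \<and>
      set ws \<subseteq> comm_gens G H \<union> (\<lambda>c. inv c) ` comm_gens G H \<and> foldr (\<lambda>a b. a \<otimes> b) ws \<one> = y)" for k
  obtain ws where "set ws \<subseteq> comm_gens G H \<union> (\<lambda>c. inv c) ` comm_gens G H"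
    "foldr (\<lambda>a b. a \<otimes> b) ws \<one> = y"
    using assms comm_ball_words[of n y] by auto
  then have "Q (length ws)" unfolding Q_def by (intro exI[of _ ws] conjI refl)
  then have "Q (cl G H y)" unfolding cl_def Q_def[symmetric] by (rule LeastI)
  then show ?thesis unfolding Q_def comm_ball_words[of "cl G H y" y]
    by (elim exE) (rule exI, auto)
qed

lemma comm_subgroup_iff: "y \<in> comm_subgroup G H \<longleftrightarrow> (\<exists>n. comm_ball n y)"
proof
  assume "y \<in> comm_subgroup G H"
  then show "\<exists>n. comm_ball n y"
    unfolding comm_subgroup_def
  proof (induction rule: generate.induct)
    case one
    then show ?case using comm_ball_one by blast
  next
    case (incl h)
    then show ?case using comm_ball_mcomm by (auto simp: comm_gens_def)
  next
    case (inv h)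
    then show ?case using comm_ball_inv_mcomm by (auto simp: comm_gens_def)
  next
    case (eng h1 h2)
    then show ?case using comm_ball_mult by blast
  qed
next
  assume "\<exists>n. comm_ball n y"
  then obtain n where "comm_ball n y" by blast
  then show "y \<in> comm_subgroup G H"
    unfolding comm_subgroup_def
  proof (induction rule: comm_ball.induct)
    case (comm_ball_one n)
    show ?case by (rule generate.one)
  next
    case (comm_ball_gen g x n y)
    then show ?case by (intro generate.eng[OF generate.incl]) (auto simp: comm_gens_def)
  next
    case (comm_ball_inv_gen g x n y)
    then show ?case by (intro generate.eng[OF generate.inv]) (auto simp: comm_gens_def)
  qed
qed

text \<open>Distance at most \<open>c\<close> in the word metric of mixed commutators. Lengths are
  conjugation invariant, so the metric is bi-invariant and bounded errors can be made anywhere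
  inside a product.\<close>

definition comm_close :: "nat \<Rightarrow> 'a \<Rightarrow> 'a \<Rightarrow> bool" where
  "comm_close c u v \<longleftrightarrow> u \<in> H \<and> v \<in> H \<and> comm_ball c (u \<otimes> inv v)"

lemma comm_close_refl: "u \<in> H \<Longrightarrow> comm_close c u u"
  by (simp add: comm_close_def comm_ball_one)

lemma comm_close_sym:
  assumes "comm_close c u v" shows "comm_close c v u"
proof -
  have "inv (u \<otimes> inv v) = v \<otimes> inv u" using assms by (simp add: comm_close_def inv_mult_group)
  then show ?thesis using assms comm_ball_inv[of c "u \<otimes> inv v"] by (simp add: comm_close_def)
qed

lemma comm_close_trans:
  assumes "comm_close c u v" "comm_close d v w" shows "comm_close (c + d) u w"
proof -
  have "(u \<otimes> inv v) \<otimes> (v \<otimes> inv w) = u \<otimes> inv w"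
    using assms by (simp add: comm_close_def m_assoc inv_cancel)
  then show ?thesis using assms comm_ball_mult[of c "u \<otimes> inv v" d "v \<otimes> inv w"]
    by (simp add: comm_close_def)
qed

lemma comm_close_mono: "comm_close c u v \<Longrightarrow> c \<le> d \<Longrightarrow> comm_close d u v"
  unfolding comm_close_def using comm_ball_mono by blast

lemma comm_close_mult:
  assumes "comm_close c u u'" "comm_close d v v'"
  shows "comm_close (c + d) (u \<otimes> v) (u' \<otimes> v')"
proof -
  have mem: "u \<in> H" "u' \<in> H" "v \<in> H" "v' \<in> H" using assms by (auto simp: comm_close_def)
  have "comm_ball (d + c) ((u \<otimes> (v \<otimes> inv v') \<otimes> inv u) \<otimes> (u \<otimes> inv u'))"
    using assms comm_ball_conj comm_ball_mult by (simp add: comm_close_def)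
  moreover have "(u \<otimes> (v \<otimes> inv v') \<otimes> inv u) \<otimes> (u \<otimes> inv u') = (u \<otimes> v) \<otimes> inv (u' \<otimes> v')"
    using mem by (simp add: m_assoc inv_cancel inv_mult_group)
  ultimately show ?thesis using mem by (simp add: comm_close_def add.commute)
qed

lemma comm_close_commute:
  assumes "x \<in> H" "y \<in> H" shows "comm_close 1 (x \<otimes> y) (y \<otimes> x)"
proof -
  have "mcomm G x y = (x \<otimes> y) \<otimes> inv (y \<otimes> x)"
    using assms by (simp add: mcomm_def m_assoc inv_mult_group)
  then show ?thesis using assms comm_ball_mcomm[of x y] by (simp add: comm_close_def)
qed

lemma comm_close_ball:
  assumes "comm_close c u v" "comm_ball n v" shows "comm_ball (c + n) u"
proof -
  have "(u \<otimes> inv v) \<otimes> v = u" using assms by (simp add: comm_close_def m_assoc)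
  then show ?thesis using assms comm_ball_mult[of c "u \<otimes> inv v" n v] by (simp add: comm_close_def)
qed

section \<open>Power words of integral chains\<close>

lemma int_pow_mem: "x \<in> H \<Longrightarrow> x [^] (n::int) \<in> H"
proof -
  assume x: "x \<in> H"
  then have "x [^] k \<in> H" for k :: nat
    by (induction k) auto
  then show "x [^] n \<in> H"
    using x by (cases n rule: int_cases) (simp_all only: int_pow_int int_pow_neg_int mem_carrier m_inv_closed)
qed

text \<open>A list of pairs \<open>(n, x)\<close> encodes the integral chain \<open>\<Sum> n x\<close>. The chains \<open>- x\<close> and
  \<open>x\<inverse>\<close> are different.\<close>

fun wprod :: "int \<Rightarrow> (int \<times> 'a) list \<Rightarrow> 'a" where
  "wprod m [] = \<one>"
| "wprod m ((n, x) # ws) = x [^] (m * n) \<otimes> wprod m ws"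

definition wscale :: "int \<Rightarrow> (int \<times> 'a) list \<Rightarrow> (int \<times> 'a) list" where
  "wscale k ws = map (\<lambda>(n, x). (k * n, x)) ws"

fun coef :: "(int \<times> 'a) list \<Rightarrow> 'a \<Rightarrow> int" where
  "coef [] y = 0"
| "coef ((n, x) # ws) y = (if x = y then n else 0) + coef ws y"

definition words :: "(int \<times> 'a) list set" where
  "words = {ws. snd ` set ws \<subseteq> H}"

lemma words_simps [simp]:
  "[] \<in> words" "(n, x) # ws \<in> words \<longleftrightarrow> x \<in> H \<and> ws \<in> words"
  "ws @ ws' \<in> words \<longleftrightarrow> ws \<in> words \<and> ws' \<in> words" "wscale k ws \<in> words \<longleftrightarrow> ws \<in> words"
  by (auto simp: words_def wscale_def image_subset_iff)

lemma coef_append [simp]: "coef (ws @ ws') y = coef ws y + coef ws' y"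
  by (induction ws) auto

lemma coef_wscale [simp]: "coef (wscale k ws) y = k * coef ws y"
  by (induction ws) (auto simp: wscale_def algebra_simps)

lemma wprod_mem [simp]: "ws \<in> words \<Longrightarrow> wprod m ws \<in> H"
  by (induction m ws rule: wprod.induct) (auto simp: int_pow_mem)

lemma wprod_append: "ws \<in> words \<Longrightarrow> ws' \<in> words \<Longrightarrow> wprod m (ws @ ws') = wprod m ws \<otimes> wprod m ws'"
  by (induction m ws rule: wprod.induct) (auto simp: m_assoc int_pow_mem)

lemma wprod_wscale: "wprod m (wscale k ws) = wprod (m * k) ws"
  by (induction ws) (auto simp: wscale_def mult.assoc)

lemma wprod_0: "ws \<in> words \<Longrightarrow> wprod 0 ws = \<one>"
  by (induction ws) auto

text \<open>Each entry is moved past one block, at one commutator per entry whatever the exponents.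
  The error is uniform in \<open>m\<close> and \<open>m'\<close>, as almost subadditivity
  requires.\<close>

lemma wprod_add:
  "ws \<in> words \<Longrightarrow> comm_close (length ws) (wprod (m + m') ws) (wprod m ws \<otimes> wprod m' ws)"
proof (induction ws)
  case Nil
  then show ?case by (simp add: comm_close_refl)
next
  case (Cons p ws)
  obtain n x where p: "p = (n, x)" by (cases p)
  define a a' u u' where "a = x [^] (m * n)" and "a' = x [^] (m' * n)"
    and "u = wprod m ws" and "u' = wprod m' ws"
  have x: "x \<in> H" and ws: "ws \<in> words" using Cons.prems p by auto
  have mem: "a \<in> H" "a' \<in> H" "u \<in> H" "u' \<in> H"
    using x ws by (auto simp: a_def a'_def u_def u'_def int_pow_mem)
  have "comm_close (0 + length ws) ((a \<otimes> a') \<otimes> wprod (m + m') ws) ((a \<otimes> a') \<otimes> (u \<otimes> u'))"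
    using Cons.IH[OF ws] mem comm_close_refl unfolding u_def u'_def by (intro comm_close_mult) auto
  moreover have "comm_close (0 + (1 + 0)) (a \<otimes> ((a' \<otimes> u) \<otimes> u')) (a \<otimes> ((u \<otimes> a') \<otimes> u'))"
    using mem by (intro comm_close_mult comm_close_commute comm_close_refl)
  moreover have "a \<otimes> ((a' \<otimes> u) \<otimes> u') = (a \<otimes> a') \<otimes> (u \<otimes> u')"
    "a \<otimes> ((u \<otimes> a') \<otimes> u') = (a \<otimes> u) \<otimes> (a' \<otimes> u')"
    using mem by (simp_all add: m_assoc)
  ultimately have "comm_close (length ws + 1) ((a \<otimes> a') \<otimes> wprod (m + m') ws) ((a \<otimes> u) \<otimes> (a' \<otimes> u'))"
    using comm_close_trans by fastforce
  moreover have "x [^] ((m + m') * n) = a \<otimes> a'"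
    using x by (simp add: a_def a'_def int_pow_mult distrib_right)
  ultimately show ?case by (simp add: p a_def a'_def u_def u'_def)
qed

text \<open>Powers of \<open>y\<close> are collected at the front; passing an entry costs one
  commutator, independently of \<open>m\<close>.\<close>

lemma wprod_extract:
  "ws \<in> words \<Longrightarrow> y \<in> H \<Longrightarrow>
    comm_close (length ws) (wprod m ws) (y [^] (m * coef ws y) \<otimes> wprod m (filter (\<lambda>p. snd p \<noteq> y) ws))"
proof (induction ws)
  case Nil
  then show ?case by (simp add: comm_close_refl)
next
  case (Cons p ws)
  obtain n x where p: "p = (n, x)" by (cases p)
  define a b f where "a = x [^] (m * n)" and "b = y [^] (m * coef ws y)"
    and "f = wprod m (filter (\<lambda>p. snd p \<noteq> y) ws)"
  have x: "x \<in> H" and ws: "ws \<in> words" using Cons.prems p by auto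
  then have "filter (\<lambda>p. snd p \<noteq> y) ws \<in> words" by (auto simp: words_def)
  then have mem: "a \<in> H" "b \<in> H" "f \<in> H"
    using x Cons.prems by (auto simp: a_def b_def f_def int_pow_mem)
  have step: "comm_close (0 + length ws) (a \<otimes> wprod m ws) (a \<otimes> (b \<otimes> f))"
    using Cons.IH[OF ws] Cons.prems mem comm_close_refl unfolding b_def f_def
    by (intro comm_close_mult) auto
  show ?case
  proof (cases "x = y")
    case True
    have "a \<otimes> (b \<otimes> f) = y [^] (m * (n + coef ws y)) \<otimes> f"
      using mem Cons.prems True
      by (simp add: a_def b_def distrib_left int_pow_mult m_assoc)
    then show ?thesis
      using step True comm_close_mono[OF step, of "Suc (length ws)"] by (simp add: p a_def f_def)
  next
    case False
    have "comm_close (1 + 0) ((a \<otimes> b) \<otimes> f) ((b \<otimes> a) \<otimes> f)"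
      using mem by (intro comm_close_mult comm_close_commute comm_close_refl)
    then have swap: "comm_close (1 + 0) (a \<otimes> (b \<otimes> f)) (b \<otimes> (a \<otimes> f))"
      using mem by (simp add: m_assoc)
    have "comm_close (Suc (length ws)) (a \<otimes> wprod m ws) (b \<otimes> (a \<otimes> f))"
      using comm_close_trans[OF step swap] by simp
    then show ?thesis using False by (simp add: p a_def b_def f_def)
  qed
qed

lemma coef_filter: "coef (filter (\<lambda>p. snd p \<noteq> y) ws) z = (if z = y then 0 else coef ws z)"
  by (induction ws) auto

text \<open>Collecting the first letter leaves it with exponent \<open>m * 0\<close>, so it
  disappears and a shorter list with zero coefficients remains. Several entries may go at once,
  hence induction on the length.\<close>

lemma wprod_null:
  "ws \<in> words \<Longrightarrow> (\<And>y. coef ws y = 0) \<Longrightarrow> \<exists>c. \<forall>m. comm_ball c (wprod m ws)"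
proof (induction ws rule: length_induct)
  case (1 ws)
  show ?case
  proof (cases ws)
    case Nil
    then show ?thesis by (auto intro: comm_ball_one)
  next
    case (Cons p ws')
    obtain n y where p: "p = (n, y)" by (cases p)
    define fs where "fs = filter (\<lambda>p. snd p \<noteq> y) ws"
    have y: "y \<in> H" using 1 Cons p by simp
    have "length fs < length ws"
      using length_filter_le[of "\<lambda>p. snd p \<noteq> y" ws'] by (simp add: fs_def Cons p less_Suc_eq_le)
    moreover have fs: "fs \<in> words" using 1(2) by (auto simp: fs_def words_def)
    moreover have "coef fs z = 0" for z using 1(3) by (simp add: fs_def coef_filter)
    ultimately obtain c where c: "\<And>m. comm_ball c (wprod m fs)" using 1(1) by blast
    have "comm_ball (length ws + c) (wprod m ws)" for m
      using wprod_extract[OF 1(2) y, of m] 1(3) c[of m] fs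
      by (intro comm_close_ball[where v = "wprod m fs"]) (simp_all add: fs_def[symmetric])
    then show ?thesis by blast
  qed
qed

text \<open>Both words cancel against the same negated list up to a bounded error. Hence stable
  length depends on the chain only, not on the list.\<close>

lemma wprod_coef_cong:
  assumes "ws \<in> words" "ws' \<in> words" "coef ws = coef ws'"
  shows "\<exists>c. \<forall>m. comm_close c (wprod m ws) (wprod m ws')"
proof -
  let ?v = "wscale (- 1) ws'"
  obtain c where c: "\<And>m. comm_ball c (wprod m (ws @ ?v))"
    using wprod_null[of "ws @ ?v"] assms by auto
  obtain d where d: "\<And>m. comm_ball d (wprod m (ws' @ ?v))"
    using wprod_null[of "ws' @ ?v"] assms by auto
  have "comm_close (c + d) (wprod m ws) (wprod m ws')" for m
  proof -
    define x y z where "x = wprod m ws" and "y = wprod m ws'" and "z = wprod m ?v"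
    have mem: "x \<in> H" "y \<in> H" "z \<in> H" using assms by (auto simp: x_def y_def z_def)
    have "comm_ball c (x \<otimes> z)" "comm_ball d (y \<otimes> z)"
      using c[of m] d[of m] assms by (simp_all add: wprod_append x_def y_def z_def)
    then have "comm_ball (c + d) ((x \<otimes> z) \<otimes> inv (y \<otimes> z))"
      by (intro comm_ball_mult comm_ball_inv)
    moreover have "(x \<otimes> z) \<otimes> inv (y \<otimes> z) = x \<otimes> inv y"
      using mem by (simp add: m_assoc inv_mult_group inv_cancel)
    ultimately show ?thesis using mem by (simp add: comm_close_def x_def y_def)
  qed
  then show ?thesis by blast
qed

text \<open>These are the chains on which \<open>cl\<close> is meaningful. Modulo [G,H] the group
  \<open>H\<close> is abelian, so the condition at exponent 1 passes to all exponents, negative ones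
  included.\<close>

definition admissible :: "(int \<times> 'a) list \<Rightarrow> bool" where
  "admissible ws \<longleftrightarrow> ws \<in> words \<and> wprod 1 ws \<in> comm_subgroup G H"

lemma admissible_ball:
  assumes "admissible ws" shows "\<exists>n. comm_ball n (wprod m ws)"
proof -
  have ws: "ws \<in> words" and one: "wprod 1 ws \<in> comm_subgroup G H"
    using assms by (auto simp: admissible_def)
  then obtain d where d: "comm_ball d (wprod 1 ws)" using comm_subgroup_iff by blast
  let ?Q = "\<lambda>m. \<exists>n. comm_ball n (wprod m ws)"
  have mem: "wprod m ws \<in> H" for m using ws by simp
  have up: "?Q (m + 1)" if "?Q m" for m
    using that d comm_ball_mult comm_close_ball[OF wprod_add[OF ws, of m 1]] by blast
  have down: "?Q m" if Q: "?Q (m + 1)" for m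
  proof -
    obtain n where n: "comm_ball n (wprod (m + 1) ws)" using Q by blast
    have "comm_ball (length ws + n + d) ((wprod m ws \<otimes> wprod 1 ws) \<otimes> inv (wprod 1 ws))"
      using comm_close_ball[OF comm_close_sym[OF wprod_add[OF ws]] n] comm_ball_inv[OF d]
      by (rule comm_ball_mult)
    moreover have "(wprod m ws \<otimes> wprod 1 ws) \<otimes> inv (wprod 1 ws) = wprod m ws"
      using mem by (simp add: m_assoc)
    ultimately show ?thesis by auto
  qed
  show ?thesis
  proof (induction m rule: int_induct[of _ 0])
    case base
    then show ?case using comm_ball_one by (auto simp: wprod_0[OF ws])
  next
    case (step1 i)
    then show ?case using up by blast
  next
    case (step2 i)
    then show ?case using down[of "i - 1"] by simp
  qed
qed

lemma admissible_wscale: "admissible ws \<Longrightarrow> admissible (wscale k ws)"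
  using admissible_ball[of ws k] by (simp add: admissible_def wprod_wscale comm_subgroup_iff)

lemma admissible_append: "admissible ws \<Longrightarrow> admissible ws' \<Longrightarrow> admissible (ws @ ws')"
  unfolding admissible_def comm_subgroup_iff by (auto simp: wprod_append intro: comm_ball_mult)

lemma admissible_cl: "admissible ws \<Longrightarrow> comm_ball (cl G H (wprod m ws)) (wprod m ws)"
  using admissible_ball comm_ball_cl by blast

section \<open>Stable length of integral chains; it is \<open>scl\<close> on a single element of
  [G,H]\<close>

definition stable_cl :: "(int \<times> 'a) list \<Rightarrow> real" where
  "stable_cl ws = lim (\<lambda>m::nat. real (cl G H (wprod (int m) ws)) / real m)"

lemma stable_cl_LIMSEQ:
  assumes "admissible ws"
  shows "(\<lambda>m::nat. real (cl G H (wprod (int m) ws)) / real m) \<longlonglongrightarrow> stable_cl ws"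
proof -
  have ws: "ws \<in> words" using assms by (simp add: admissible_def)
  have "cl G H (wprod (int (m + n)) ws)
      \<le> length ws + (cl G H (wprod (int m) ws) + cl G H (wprod (int n) ws))" for m n
    using comm_close_ball[OF wprod_add[OF ws] comm_ball_mult[OF admissible_cl admissible_cl]] assms
    by (intro cl_le) simp
  then have "real (cl G H (wprod (int (m + n)) ws))
      \<le> real (cl G H (wprod (int m) ws)) + real (cl G H (wprod (int n) ws)) + real (length ws)" for m n
    by (metis of_nat_add of_nat_mono add.commute)
  then have "convergent (\<lambda>m::nat. real (cl G H (wprod (int m) ws)) / real m)"
    by (intro almost_subadditive_quotient_convergent[where c = "real (length ws)"]) auto
  then show ?thesis unfolding stable_cl_def by (simp add: convergent_LIMSEQ_iff)
qed

lemma stable_cl_le: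
  assumes "admissible ws" and "\<And>m. real (cl G H (wprod (int m) ws)) \<le> b m + c"
    and "(\<lambda>m. b m / real m) \<longlonglongrightarrow> r"
  shows "stable_cl ws \<le> r"
proof (rule LIMSEQ_le[OF stable_cl_LIMSEQ[OF assms(1)]])
  have "(\<lambda>m. b m / real m + c / real m) \<longlonglongrightarrow> r + 0"
    by (intro tendsto_intros assms(3) lim_const_over_n)
  then show "(\<lambda>m. b m / real m + c / real m) \<longlonglongrightarrow> r" by simp
  show "\<exists>N. \<forall>m\<ge>N. real (cl G H (wprod (int m) ws)) / real m \<le> b m / real m + c / real m"
    using assms(2) by (auto simp: add_divide_distrib[symmetric] intro!: divide_right_mono)
qed

lemma stable_cl_nonneg: "admissible ws \<Longrightarrow> 0 \<le> stable_cl ws"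
  by (rule LIMSEQ_le_const[OF stable_cl_LIMSEQ]) auto

lemma stable_cl_append:
  assumes "admissible ws" "admissible ws'"
  shows "stable_cl (ws @ ws') \<le> stable_cl ws + stable_cl ws'"
proof (rule stable_cl_le[where c = 0])
  show "admissible (ws @ ws')" using assms by (rule admissible_append)
  show "(\<lambda>m. (real (cl G H (wprod (int m) ws)) + real (cl G H (wprod (int m) ws'))) / real m)
      \<longlonglongrightarrow> stable_cl ws + stable_cl ws'"
    unfolding add_divide_distrib by (intro tendsto_intros stable_cl_LIMSEQ assms)
  fix m
  have "cl G H (wprod (int m) (ws @ ws')) \<le> cl G H (wprod (int m) ws) + cl G H (wprod (int m) ws')"
    using assms comm_ball_mult[OF admissible_cl admissible_cl] wprod_append
    by (intro cl_le) (simp add: admissible_def)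
  then show "real (cl G H (wprod (int m) (ws @ ws')))
      \<le> real (cl G H (wprod (int m) ws)) + real (cl G H (wprod (int m) ws')) + 0"
    by simp
qed

text \<open>Scaling the chain by \<open>k\<close> samples the same sequence along the multiples of
  \<open>k\<close>.\<close>

lemma stable_cl_wscale:
  assumes "admissible ws" "0 < k"
  shows "stable_cl (wscale k ws) = of_int k * stable_cl ws"
proof -
  obtain l where l: "k = int l" "0 < l" using assms(2) by (metis zero_less_imp_eq_int)
  have "strict_mono (\<lambda>m. m * l)" using l(2) by (intro strict_monoI) simp
  from LIMSEQ_subseq_LIMSEQ[OF stable_cl_LIMSEQ[OF assms(1)] this]
  have "(\<lambda>m. real l * (real (cl G H (wprod (int (m * l)) ws)) / real (m * l))) \<longlonglongrightarrow> real l * stable_cl ws"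
    by (intro tendsto_mult_left) (simp add: o_def)
  moreover have "real l * (real (cl G H (wprod (int (m * l)) ws)) / real (m * l))
      = real (cl G H (wprod (int m) (wscale k ws))) / real m" for m
    using l by (simp add: wprod_wscale)
  ultimately show ?thesis
    using LIMSEQ_unique[OF stable_cl_LIMSEQ[OF admissible_wscale[OF assms(1)]]] l(1) by simp
qed

lemma admissible_close:
  assumes "comm_close c (wprod 1 ws) (wprod 1 ws')" "ws \<in> words" "admissible ws'"
  shows "admissible ws"
  using assms comm_close_ball[OF assms(1)] unfolding admissible_def comm_subgroup_iff by blast

lemma stable_cl_close:
  assumes "\<And>m. comm_close c (wprod m ws) (wprod m ws')" "ws \<in> words" "admissible ws'"
  shows "stable_cl ws \<le> stable_cl ws'"
proof (rule stable_cl_le[where c = "real c"])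
  show "admissible ws" using assms admissible_close by blast
  show "(\<lambda>m. real (cl G H (wprod (int m) ws')) / real m) \<longlonglongrightarrow> stable_cl ws'"
    by (rule stable_cl_LIMSEQ[OF assms(3)])
  fix m
  have "cl G H (wprod (int m) ws) \<le> c + cl G H (wprod (int m) ws')"
    by (intro cl_le comm_close_ball[OF assms(1)] admissible_cl assms(3))
  then show "real (cl G H (wprod (int m) ws)) \<le> real (cl G H (wprod (int m) ws')) + real c"
    by simp
qed

lemma stable_cl_coef_cong:
  assumes "admissible ws" "admissible ws'" "coef ws = coef ws'"
  shows "stable_cl ws = stable_cl ws'"
proof -
  have "ws \<in> words" "ws' \<in> words" using assms by (auto simp: admissible_def)
  then show ?thesis
    using wprod_coef_cong[of ws ws'] wprod_coef_cong[of ws' ws] stable_cl_close assms by (metis antisym)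
qed

text \<open>\<open>wprod (- m) ws\<close> has the inverse powers in unreversed order, so it is the
  inverse of \<open>wprod m ws\<close> only up to \<open>length ws\<close> commutators.\<close>

lemma stable_cl_neg_le:
  assumes "admissible ws" shows "stable_cl (wscale (- 1) ws) \<le> stable_cl ws"
proof -
  have ws: "ws \<in> words" using assms by (simp add: admissible_def)
  show ?thesis
  proof (rule stable_cl_le[where c = "real (length ws)"])
    show "admissible (wscale (- 1) ws)" using assms by (rule admissible_wscale)
    show "(\<lambda>m. real (cl G H (wprod (int m) ws)) / real m) \<longlonglongrightarrow> stable_cl ws"
      by (rule stable_cl_LIMSEQ[OF assms])
    fix m
    let ?u = "wprod (int m) ws" and ?v = "wprod (- int m) ws"
    have "comm_ball (length ws) (?v \<otimes> ?u)"
      using comm_close_sym[OF wprod_add[OF ws, of "- int m" "int m"]] ws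
      by (simp add: comm_close_def wprod_0)
    then have "comm_ball (length ws + cl G H ?u) ((?v \<otimes> ?u) \<otimes> inv ?u)"
      by (intro comm_ball_mult comm_ball_inv admissible_cl assms)
    moreover have "(?v \<otimes> ?u) \<otimes> inv ?u = ?v" using ws by (simp add: m_assoc)
    ultimately have "cl G H ?v \<le> length ws + cl G H ?u" by (intro cl_le) simp
    then show "real (cl G H (wprod (int m) (wscale (- 1) ws)))
        \<le> real (cl G H ?u) + real (length ws)"
      by (simp add: wprod_wscale)
  qed
qed

lemma pow_Suc_swap:
  assumes "a \<in> carrier G" "b \<in> carrier G"
  shows "(a \<otimes> b) [^] Suc k = a \<otimes> (b \<otimes> a) [^] k \<otimes> b"
proof (induction k)
  case (Suc k)
  have "(a \<otimes> b) [^] Suc (Suc k) = (a \<otimes> (b \<otimes> a) [^] k \<otimes> b) \<otimes> (a \<otimes> b)"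
    using Suc by simp
  also have "\<dots> = a \<otimes> (b \<otimes> a) [^] Suc k \<otimes> b"
    using assms by (simp add: m_assoc)
  finally show ?case .
qed (use assms in simp)

text \<open>A pair of pants has an \<open>m\<close>-fold cover with three boundary components when \<open>m\<close> is odd,
  so that one commutator reduces the exponent by two.\<close>

lemma power_word_ball:
  assumes "a \<in> H" "b \<in> H"
  shows "comm_ball (Suc m div 2) (inv a [^] m \<otimes> inv b [^] m \<otimes> (a \<otimes> b) [^] m)"
proof (induction m rule: nat_induct2)
  case 0
  then show ?case by (simp add: comm_ball_one)
next
  case 1
  have "inv a \<otimes> inv b \<otimes> (a \<otimes> b) = mcomm G (inv a) (inv b)"
    using assms by (simp add: mcomm_def m_assoc)
  then show ?case using comm_ball_mcomm[of "inv a" "inv b"] assms by simp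
next
  case (step k)
  have G: "a \<in> carrier G" "b \<in> carrier G" using assms by auto
  have nat_pow_mem: "x \<in> H \<Longrightarrow> x [^] (n::nat) \<in> H" for x n
    by (induction n) auto
  define w where "w = inv a [^] Suc k \<otimes> inv b [^] Suc k"
  define u where "u = (b \<otimes> a) [^] Suc k"
  have mem: "w \<in> H" "u \<in> H" using assms by (simp_all add: w_def u_def nat_pow_mem del: nat_pow_Suc)
  then have G': "w \<in> carrier G" "u \<in> carrier G" by auto
  \<comment> \<open>At the seam one \<open>a\<close> cancels; what is left is a conjugate by
    \<open>b\<close> of a rotation of the word for exponent \<open>k\<close>, to which the induction
    hypothesis applies.\<close>
  have uw: "u \<otimes> w = b \<otimes> ((a \<otimes> b) [^] k \<otimes> (inv a [^] k \<otimes> inv b [^] k)) \<otimes> inv b"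
    unfolding u_def w_def pow_Suc_swap[OF G(2,1)] nat_pow_Suc2[OF inv_closed[OF G(1)]]
    unfolding nat_pow_Suc using G by (simp add: m_assoc inv_cancel)
  have "comm_ball (Suc k div 2) (u \<otimes> w)"
    unfolding uw using step G
    by (subst comm_ball_conj_iff, simp, simp, subst comm_ball_rotate) (simp_all add: m_assoc)
  \<comment> \<open>Chosen so that \<open>u w\<close> times this commutator is conjugate by
    \<open>u\<close> to a rotation of the word for exponent \<open>k + 2\<close>: one commutator
    pays for two exponents.\<close>
  moreover have "comm_ball 1 (mcomm G (inv w \<otimes> a) (u \<otimes> b))"
    using mem assms by (intro comm_ball_mcomm) auto
  ultimately have "comm_ball (Suc k div 2 + 1) (u \<otimes> w \<otimes> mcomm G (inv w \<otimes> a) (u \<otimes> b))"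
    by (rule comm_ball_mult)
  moreover have "u \<otimes> w \<otimes> mcomm G (inv w \<otimes> a) (u \<otimes> b)
      = u \<otimes> ((a \<otimes> u \<otimes> b) \<otimes> (inv a \<otimes> w \<otimes> inv b)) \<otimes> inv u"
    using G G' by (simp add: mcomm_def m_assoc inv_mult_group inv_cancel)
  ultimately have "comm_ball (Suc k div 2 + 1) ((inv a \<otimes> w \<otimes> inv b) \<otimes> (a \<otimes> u \<otimes> b))"
    using G G' by (simp add: comm_ball_conj_iff comm_ball_rotate[of "inv a \<otimes> w \<otimes> inv b"])
  moreover have "(inv a \<otimes> w \<otimes> inv b) \<otimes> (a \<otimes> u \<otimes> b)
      = inv a [^] (k + 2) \<otimes> inv b [^] (k + 2) \<otimes> (a \<otimes> b) [^] (k + 2)"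
    unfolding w_def u_def pow_Suc_swap[OF G, symmetric] add_2_eq_Suc'
      nat_pow_Suc2[OF inv_closed[OF G(1)], of "Suc k"] nat_pow_Suc[of "inv b" "Suc k"]
    using G by (simp add: m_assoc del: nat_pow_Suc)
  ultimately show ?case by simp
qed

end

section \<open>The seminorm on rational chains and its dual\<close>

text \<open>A subspace over the rationals has a complement, by extending a basis. Of the resulting
  linear projection only additivity is recorded.\<close>

lemma rational_projection:
  fixes S :: "('a \<Rightarrow> rat) set"
  assumes zero: "0 \<in> S" and add: "\<And>u v. u \<in> S \<Longrightarrow> v \<in> S \<Longrightarrow> u + v \<in> S"
    and scale: "\<And>r v. v \<in> S \<Longrightarrow> (\<lambda>x. r * v x) \<in> S"
  shows "\<exists>\<pi>. (\<forall>v. \<pi> v \<in> S) \<and> (\<forall>v\<in>S. \<pi> v = v) \<and> (\<forall>u v. \<pi> (u + v) = \<pi> u + \<pi> v)"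
proof -
  let ?s = "\<lambda>(r::rat) (v::'a \<Rightarrow> rat) x. r * v x"
  interpret V: vector_space ?s
    by unfold_locales (auto simp: fun_eq_iff algebra_simps)
  interpret VV: vector_space_pair ?s ?s ..
  have "V.subspace S" unfolding V.subspace_def using zero add scale by auto
  moreover have "Vector_Spaces.linear ?s ?s id" by (rule V.linear_id)
  ultimately obtain \<pi> where "\<pi> ` UNIV \<subseteq> S" "Vector_Spaces.linear ?s ?s \<pi>" "\<forall>v\<in>S. \<pi> (id v) = v"
    using VV.linear_exists_left_inverse_on[of id S] by auto
  then show ?thesis
    by (intro exI[of _ \<pi>]) (auto simp: Vector_Spaces.linear_iff)
qed

lemma additive_zero: "(\<And>x y. f (x + y) = f x + f y) \<Longrightarrow> f 0 = 0"
  for f :: "'v::ab_group_add \<Rightarrow> 'w::ab_group_add"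
  by (metis add.right_neutral add_left_cancel)

lemma additive_uminus: "(\<And>x y. f (x + y) = f x + f y) \<Longrightarrow> f (- x) = - f x"
  for f :: "'v::ab_group_add \<Rightarrow> 'w::ab_group_add"
  by (metis additive_zero add.right_inverse minus_unique)

context normal
begin

section \<open>Rational chains\<close>

definition chain :: "(int \<times> 'a) list \<Rightarrow> 'a \<Rightarrow> rat" where
  "chain ws = (\<lambda>y. of_int (coef ws y))"

lemma chain_append: "chain (ws @ ws') = chain ws + chain ws'"
  by (simp add: chain_def fun_eq_iff)

lemma chain_wscale: "chain (wscale k ws) = (\<lambda>y. of_int k * chain ws y)"
  by (simp add: chain_def)

lemma chain_inject: "chain ws = chain ws' \<Longrightarrow> coef ws = coef ws'"
  by (simp add: chain_def fun_eq_iff)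

text \<open>Clears denominators: the stable length of \<open>v\<close> is to be
  \<open>stable_cl ws / k\<close>.\<close>

definition represents :: "int \<Rightarrow> (int \<times> 'a) list \<Rightarrow> ('a \<Rightarrow> rat) \<Rightarrow> bool" where
  "represents k ws v \<longleftrightarrow> 0 < k \<and> admissible ws \<and> (\<lambda>y. of_int k * v y) = chain ws"

lemma represents_apply: "represents k ws v \<Longrightarrow> chain ws y = of_int k * v y"
  using fun_cong[of "\<lambda>y. of_int k * v y" "chain ws" y] by (simp add: represents_def)

text \<open>Cross-multiplying gives two lists for the same integral chain.\<close>

lemma represents_unique:
  assumes "represents k ws v" "represents k' ws' v"
  shows "stable_cl ws / of_int k = stable_cl ws' / of_int k'"
proof -
  have pos: "0 < k" "0 < k'" and adm: "admissible ws" "admissible ws'"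
    using assms by (auto simp: represents_def)
  have "chain (wscale k' ws) = chain (wscale k ws')"
    using assms by (simp add: chain_wscale represents_apply fun_eq_iff)
  then have "stable_cl (wscale k' ws) = stable_cl (wscale k ws')"
    using adm by (intro stable_cl_coef_cong chain_inject admissible_wscale)
  then show ?thesis using pos adm by (simp add: stable_cl_wscale field_simps)
qed

lemma represents_add:
  assumes "represents k ws v" "represents k' ws' v'"
  shows "represents (k * k') (wscale k' ws @ wscale k ws') (v + v')"
proof -
  have "of_int (k * k') * (v + v') y = chain (wscale k' ws @ wscale k ws') y" for y
    using assms by (simp add: chain_append chain_wscale represents_apply algebra_simps)
  then show ?thesis
    using assms admissible_append admissible_wscale by (auto simp: represents_def)
qed

lemma represents_scale:
  assumes "represents k ws v" "0 < j"
  shows "represents (k * j) (wscale i ws) (\<lambda>y. of_int i / of_int j * v y)"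
proof -
  have "of_int (k * j) * (of_int i / of_int j * v y) = chain (wscale i ws) y" for y
    using assms by (simp add: chain_wscale represents_apply)
  then show ?thesis using assms admissible_wscale by (auto simp: represents_def)
qed

lemma represents_chain: "admissible ws \<Longrightarrow> represents 1 ws (chain ws)"
  by (simp add: represents_def)

text \<open>\<open>P\<close> is only a seminorm, with a large kernel: besides the complement of
  \<open>S\<close> it kills the relations that make functionals homogeneous and invariant.\<close>

lemma stable_seminorm_exists:
  "\<exists>P. sublin P \<and> (\<forall>v. P (- v) = P v) \<and> (\<forall>ws. admissible ws \<longrightarrow> P (chain ws) = stable_cl ws)"
proof -
  define S where "S = {v. \<exists>k ws. represents k ws v}"
  define p where "p v = (SOME r. \<exists>k ws. represents k ws v \<and> r = stable_cl ws / of_int k)" for v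
  have p_eq: "p v = stable_cl ws / of_int k" if "represents k ws v" for k ws v
    unfolding p_def by (rule some_equality) (use that represents_unique in blast)+
  have S_add: "u + v \<in> S" if "u \<in> S" "v \<in> S" for u v
    using that represents_add unfolding S_def by blast
  have S_scale: "(\<lambda>y. r * v y) \<in> S" if "v \<in> S" for r v
  proof -
    obtain i j where "quotient_of r = (i, j)" by fastforce
    then have "r = of_int i / of_int j" "0 < j"
      using quotient_of_div quotient_of_denom_pos by blast+
    then show ?thesis using that represents_scale unfolding S_def by blast
  qed
  have "admissible []" by (simp add: admissible_def comm_subgroup_iff comm_ball_one exI[of _ 0])
  then have "chain [] \<in> S" using represents_chain by (auto simp: S_def)
  then have S_zero: "0 \<in> S" by (simp add: chain_def zero_fun_def)
  \<comment> \<open>Stable length is infinite off \<open>S\<close>; composing with a projection onto \<open>S\<close> makes it finite everywhere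
    and extends functionals from \<open>S\<close> at the same time.\<close>
  obtain \<pi> where \<pi>: "\<And>v. \<pi> v \<in> S" "\<And>v. v \<in> S \<Longrightarrow> \<pi> v = v" "\<And>u v. \<pi> (u + v) = \<pi> u + \<pi> v"
    using rational_projection[of S] S_zero S_add S_scale by blast
  have p_add: "p (u + v) \<le> p u + p v" if "u \<in> S" "v \<in> S" for u v
  proof -
    obtain k ws k' ws' where r: "represents k ws u" "represents k' ws' v"
      using \<open>u \<in> S\<close> \<open>v \<in> S\<close> by (auto simp: S_def)
    then have pos: "0 < k" "0 < k'" and adm: "admissible ws" "admissible ws'"
      by (auto simp: represents_def)
    have "stable_cl (wscale k' ws @ wscale k ws') \<le> of_int k' * stable_cl ws + of_int k * stable_cl ws'"
      using stable_cl_append[of "wscale k' ws" "wscale k ws'"] pos adm by (simp add: admissible_wscale stable_cl_wscale)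
    then have "p (u + v) \<le> (of_int k' * stable_cl ws + of_int k * stable_cl ws') / of_int (k * k')"
      using p_eq[OF represents_add[OF r]] pos by (simp add: divide_right_mono)
    also have "\<dots> = p u + p v"
      using p_eq[OF r(1)] p_eq[OF r(2)] pos by (simp add: add_divide_distrib)
    finally show ?thesis .
  qed
  have p_dbl: "p (v + v) = 2 * p v" if v: "v \<in> S" for v
  proof -
    obtain k ws where r: "represents k ws v" using v by (auto simp: S_def)
    have "(\<lambda>y. of_int 2 / of_int 1 * v y) = v + v" by (simp add: fun_eq_iff)
    then have "represents k (wscale 2 ws) (v + v)" using represents_scale[OF r, of 1 2] by simp
    then show ?thesis using p_eq[OF r] p_eq r stable_cl_wscale[of ws 2] by (auto simp: represents_def)
  qed
  have p_neg: "p (- v) \<le> p v" if v: "v \<in> S" for v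
  proof -
    obtain k ws where r: "represents k ws v" using v by (auto simp: S_def)
    have "(\<lambda>y. of_int (- 1) / of_int 1 * v y) = - v" by (simp add: fun_eq_iff)
    then have "represents k (wscale (- 1) ws) (- v)" using represents_scale[OF r, of 1 "- 1"] by simp
    then show ?thesis
      using p_eq[OF r] p_eq[of k "wscale (- 1) ws" "- v"] r stable_cl_neg_le[of ws]
        divide_right_mono[of "stable_cl (wscale (- 1) ws)" "stable_cl ws" "of_int k"]
      by (auto simp: represents_def)
  qed
  have \<pi>_neg: "\<pi> (- v) = - \<pi> v" for v by (rule additive_uminus[of \<pi>, OF \<pi>(3)])
  show ?thesis
  proof (intro exI[of _ "\<lambda>v. p (\<pi> v)"] conjI allI impI)
    show "sublin (\<lambda>v. p (\<pi> v))"
      unfolding sublin_def \<pi>(3) using \<pi>(1) p_add p_dbl by blast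
    show "p (\<pi> (- v)) = p (\<pi> v)" for v
      using p_neg[OF \<pi>(1)[of v]] p_neg[OF \<pi>(1)[of "- v"]] by (simp add: \<pi>_neg)
    show "p (\<pi> (chain ws)) = stable_cl ws" if "admissible ws" for ws
    proof -
      have "chain ws \<in> S" using represents_chain[OF that] unfolding S_def by blast
      then show ?thesis using \<pi>(2) p_eq[OF represents_chain[OF that]] by simp
    qed
  qed
qed

lemma stable_cl_ball_le:
  assumes "ws \<in> words" and ball: "\<And>m. comm_ball (B m) (wprod (int m) ws)"
    and B: "\<And>m. real (B m) \<le> r * real m + c"
  shows "admissible ws \<and> stable_cl ws \<le> r"
proof
  show adm: "admissible ws"
    using ball[of 1] assms(1) by (auto simp: admissible_def comm_subgroup_iff)
  have "(\<lambda>m. r * real m / real m) \<longlonglongrightarrow> r"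
    by (intro tendsto_eventually eventually_sequentiallyI[of 1]) auto
  moreover have "real (cl G H (wprod (int m) ws)) \<le> r * real m + c" for m
    using cl_le[OF ball[of m]] B[of m] by linarith
  ultimately show "stable_cl ws \<le> r" by (intro stable_cl_le[OF adm])
qed

section \<open>From dominated functionals to invariant quasimorphisms\<close>

lemma nat_pow_conj:
  assumes "g \<in> carrier G" "x \<in> carrier G"
  shows "(g \<otimes> x \<otimes> inv g) [^] (m::nat) = g \<otimes> x [^] m \<otimes> inv g"
  using assms by (induction m) (simp_all add: conj_mult)

text \<open>Three chains are measured. For \<open>ab - a - b\<close> the power words grow with slope
  1/2, for \<open>x^n - n x\<close> they are trivial, and for \<open>g x g^-1 - x\<close> they are
  the single commutators \<open>[g, x^m]\<close>. The corresponding bounds on \<open>f\<close> are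
  \<open>K / 2\<close>, 0 and 0.\<close>

lemma functional_quasimorphism:
  fixes f P :: "('a \<Rightarrow> rat) \<Rightarrow> real"
  assumes P: "\<And>ws. admissible ws \<Longrightarrow> P (chain ws) = stable_cl ws"
    and add: "\<And>u v. f (u + v) = f u + f v" and le: "\<And>v. \<bar>f v\<bar> \<le> K * P v" and K: "0 \<le> K"
  shows "(\<lambda>x. f (chain [(1, x)])) \<in> QG G H"
    and "defect G H (\<lambda>x. f (chain [(1, x)])) \<le> K / 2"
proof -
  define \<mu> where "\<mu> x = f (chain [(1, x)])" for x
  have \<mu>_eq: "(\<lambda>x. f (chain [(1, x)])) = \<mu>" by (simp add: \<mu>_def fun_eq_iff)
  have bound: "\<bar>f (chain ws)\<bar> \<le> K * r"
    if "ws \<in> words" "\<And>m. comm_ball (B m) (wprod (int m) ws)" "\<And>m. real (B m) \<le> r * real m + c"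
    for ws B r c
    using stable_cl_ball_le[OF that] le[of "chain ws"] P[of ws] mult_left_mono[OF _ K, of "stable_cl ws" r] by auto
  have f0: "f 0 = 0" by (rule additive_zero[of f, OF add])
  have Cons: "f (chain ((n, x) # ws)) = f (chain [(n, x)]) + f (chain ws)" for n x ws
    using chain_append[of "[(n, x)]" ws] add by simp
  have multiple: "f (chain [(n, x)]) = of_int n * \<mu> x" for n x
  proof -
    have split: "f (chain [(i + j, x)]) = f (chain [(i, x)]) + f (chain [(j, x)])" for i j
    proof -
      have "chain [(i + j, x)] = chain [(i, x)] + chain [(j, x)]"
        by (simp add: chain_def fun_eq_iff)
      then show ?thesis by (simp add: add)
    qed
    have "f (chain [(0, x)]) = 0" using split[of 0 0] by simp
    then show ?thesis
    proof (induction n rule: int_induct[of _ 0])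
      case (step1 i)
      then show ?case using split[of i 1] by (simp add: \<mu>_def algebra_simps)
    next
      case (step2 i)
      then show ?case using split[of "i - 1" 1] by (simp add: \<mu>_def algebra_simps)
    qed simp
  qed
  have Nil: "f (chain []) = 0" using f0 by (simp add: chain_def zero_fun_def)
  have quasi: "\<bar>\<mu> (a \<otimes> b) - \<mu> a - \<mu> b\<bar> \<le> K / 2" if "a \<in> H" "b \<in> H" for a b
  proof -
    have "wprod (int m) [(- 1, a), (- 1, b), (1, a \<otimes> b)] = inv a [^] m \<otimes> inv b [^] m \<otimes> (a \<otimes> b) [^] m"
      for m
      using that by (simp add: int_pow_neg_int int_pow_int nat_pow_inv m_assoc)
    then have "\<bar>f (chain [(- 1, a), (- 1, b), (1, a \<otimes> b)])\<bar> \<le> K * (1 / 2)"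
      using power_word_ball[OF that] that
      by (intro bound[where B = "\<lambda>m. Suc m div 2" and c = "1 / 2"]) auto
    then show ?thesis by (simp add: Cons[of _ _ "_ # _"] multiple algebra_simps)
  qed
  have hom: "\<mu> (x [^] n) = of_int n * \<mu> x" if "x \<in> H" for x and n :: int
  proof -
    have "wprod (int m) [(1, x [^] n), (- n, x)] = \<one>" for m
      using that by (simp add: int_pow_pow int_pow_neg mult.commute int_pow_mult[symmetric])
    then have "\<bar>f (chain [(1, x [^] n), (- n, x)])\<bar> \<le> K * 0"
      using that by (intro bound[where B = "\<lambda>m. 0" and c = 0]) (auto simp: comm_ball_one int_pow_mem)
    then show ?thesis by (simp add: Cons[of _ _ "_ # _"] multiple)
  qed
  have inv: "\<mu> (g \<otimes> x \<otimes> inv g) = \<mu> x" if "g \<in> carrier G" "x \<in> H" for g x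
  proof -
    have "wprod (int m) [(1, g \<otimes> x \<otimes> inv g), (- 1, x)] = mcomm G g (x [^] m)" for m
      using that by (simp add: mcomm_def int_pow_int int_pow_neg_int nat_pow_conj)
    moreover have "x [^] (m::nat) \<in> H" for m
      using int_pow_mem[OF that(2), of "int m"] by (simp add: int_pow_int)
    ultimately have "\<bar>f (chain [(1, g \<otimes> x \<otimes> inv g), (- 1, x)])\<bar> \<le> K * 0"
      using that comm_ball_mcomm
      by (intro bound[where B = "\<lambda>m. 1" and c = 1]) (auto simp: conj_mem)
    then show ?thesis by (simp add: Cons[of _ _ "_ # _"] multiple)
  qed
  show "(\<lambda>x. f (chain [(1, x)])) \<in> QG G H"
    using quasi hom inv unfolding \<mu>_eq QG_def hom_qm_def G_invariant_def by blast
  have "H \<noteq> {}" using subgroup.one_closed[OF subgroup_axioms] by blast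
  then show "defect G H (\<lambda>x. f (chain [(1, x)])) \<le> K / 2"
    unfolding \<mu>_eq defect_def using quasi by (intro cSUP_least) auto
qed

section \<open>Invariant quasimorphisms and homomorphisms evaluated on [G,H]\<close>

lemma admissible_singleton: "z \<in> comm_subgroup G H \<Longrightarrow> admissible [(1, z)]"
  using comm_subgroup_iff comm_ball_mem by (auto simp: admissible_def)

lemma wprod_singleton: "z \<in> H \<Longrightarrow> wprod (int m) [(1, z)] = z [^] m"
  by (simp add: int_pow_int)

lemma scl_eq_stable_cl: "z \<in> comm_subgroup G H \<Longrightarrow> scl G H z = stable_cl [(1, z)]"
  using comm_subgroup_iff comm_ball_mem
  unfolding scl_def stable_cl_def by (auto simp: wprod_singleton simp del: wprod.simps)

lemma scl_nonneg: "z \<in> comm_subgroup G H \<Longrightarrow> 0 \<le> scl G H z"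
  by (simp add: scl_eq_stable_cl stable_cl_nonneg admissible_singleton)

lemma QG_inv:
  assumes "\<psi> \<in> QG G H" "x \<in> H" shows "\<psi> (inv x) = - \<psi> x"
proof -
  have "\<psi> (x [^] (- 1 :: int)) = of_int (- 1) * \<psi> x"
    using assms unfolding QG_def hom_qm_def by blast
  then show ?thesis using assms by (simp add: int_pow_neg)
qed

text \<open>The bound contained in \<open>hom_qm\<close> makes the \<open>SUP\<close> in
  \<open>defect\<close> a genuine supremum.\<close>

lemma QG_defect:
  assumes "\<psi> \<in> QG G H" "a \<in> H" "b \<in> H"
  shows "\<bar>\<psi> (a \<otimes> b) - \<psi> a - \<psi> b\<bar> \<le> defect G H \<psi>"
proof -
  obtain D where "\<forall>a\<in>H. \<forall>b\<in>H. \<bar>\<psi> (a \<otimes> b) - \<psi> a - \<psi> b\<bar> \<le> D"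
    using assms(1) by (auto simp: QG_def hom_qm_def)
  then have "bdd_above ((\<lambda>p. \<bar>\<psi> (fst p \<otimes> snd p) - \<psi> (fst p) - \<psi> (snd p)\<bar>) ` (H \<times> H))"
    by (intro bdd_aboveI2[where M = D]) auto
  from cSUP_upper[OF _ this, of "(a, b)"] show ?thesis
    using assms(2,3) by (simp add: defect_def)
qed

text \<open>By invariance, \<open>[g, x]\<close> is a product of two elements with opposite values,
  so its own value is at most one defect; multiplying it in costs a second one.\<close>

lemma QG_comm_ball:
  assumes \<psi>: "\<psi> \<in> QG G H" and "comm_ball n y"
  shows "\<bar>\<psi> y\<bar> \<le> 2 * real n * defect G H \<psi>"
  using assms(2)
proof (induction rule: comm_ball.induct)
  case (comm_ball_one n)
  have "\<psi> \<one> = 0" using QG_inv[OF \<psi>, of \<one>] by simp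
  then show ?case using QG_defect[OF \<psi>, of \<one> \<one>] by simp
next
  let ?D = "defect G H \<psi>"
  have gen: "\<bar>\<psi> (mcomm G g x)\<bar> \<le> ?D" if "g \<in> carrier G" "x \<in> H" for g x
  proof -
    have "\<psi> (g \<otimes> x \<otimes> inv g) = \<psi> x" using \<psi> that by (simp add: QG_def G_invariant_def)
    then show ?thesis
      using QG_defect[OF \<psi>, of "g \<otimes> x \<otimes> inv g" "inv x"] QG_inv[OF \<psi>, of x] that
      by (simp add: mcomm_def conj_mem)
  qed
  have step: "\<bar>\<psi> (c \<otimes> y)\<bar> \<le> 2 * real (Suc n) * ?D"
    if "c \<in> H" "y \<in> H" "\<bar>\<psi> c\<bar> \<le> ?D" "\<bar>\<psi> y\<bar> \<le> 2 * real n * ?D" for c y n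
    using QG_defect[OF \<psi> that(1,2)] that(3,4) by (simp add: algebra_simps abs_if split: if_splits)
  {
    case (comm_ball_gen g x n y)
    then show ?case using gen[of g x] comm_ball_mem by (intro step) auto
  next
    case (comm_ball_inv_gen g x n y)
    then show ?case
      using gen[of g x] QG_inv[OF \<psi>, of "mcomm G g x"] comm_ball_mem by (intro step) auto
  }
qed

text \<open>The easy half of Bavard duality: evaluate on powers of \<open>z\<close>, use homogeneity
  and divide by the exponent.\<close>

lemma QG_le_scl:
  assumes \<psi>: "\<psi> \<in> QG G H" and z: "z \<in> comm_subgroup G H"
  shows "\<bar>\<psi> z\<bar> \<le> 2 * defect G H \<psi> * scl G H z"
proof (rule LIMSEQ_le_const)
  let ?D = "defect G H \<psi>"
  have adm: "admissible [(1, z)]" using z by (rule admissible_singleton)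
  have zH: "z \<in> H" using z comm_subgroup_iff comm_ball_mem by blast
  show "(\<lambda>m. 2 * ?D * (real (cl G H (wprod (int m) [(1, z)])) / real m)) \<longlonglongrightarrow> 2 * ?D * scl G H z"
    unfolding scl_eq_stable_cl[OF z] by (intro tendsto_mult_left stable_cl_LIMSEQ adm)
  show "\<exists>M. \<forall>m\<ge>M. \<bar>\<psi> z\<bar> \<le> 2 * ?D * (real (cl G H (wprod (int m) [(1, z)])) / real m)"
  proof (intro exI[of _ 1] allI impI)
    fix m :: nat assume "1 \<le> m"
    have "\<psi> (z [^] int m) = real m * \<psi> z"
      using \<psi> zH unfolding QG_def hom_qm_def by (metis (mono_tags, lifting) mem_Collect_eq of_int_of_nat_eq)
    moreover have "\<bar>\<psi> (wprod (int m) [(1, z)])\<bar> \<le> 2 * real (cl G H (wprod (int m) [(1, z)])) * ?D"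
      by (intro QG_comm_ball[OF \<psi>] admissible_cl adm)
    ultimately have "real m * \<bar>\<psi> z\<bar> \<le> 2 * real (cl G H (wprod (int m) [(1, z)])) * ?D"
      using zH by (simp add: abs_mult)
    then show "\<bar>\<psi> z\<bar> \<le> 2 * ?D * (real (cl G H (wprod (int m) [(1, z)])) / real m)"
      using \<open>1 \<le> m\<close> by (simp add: field_simps)
  qed
qed

lemma H1G_comm_subgroup:
  assumes k: "k \<in> H1G G H" and "z \<in> comm_subgroup G H"
  shows "k z = 0"
proof -
  have add: "k (a \<otimes> b) = k a + k b" if "a \<in> H" "b \<in> H" for a b
    using k that by (simp add: H1G_def)
  have one: "k \<one> = 0" using add[of \<one> \<one>] by simp
  have inv: "k (inv a) = - k a" if "a \<in> H" for a
    using add[of a "inv a"] that one by simp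
  have gen: "k (mcomm G g x) = 0" if "g \<in> carrier G" "x \<in> H" for g x
  proof -
    have "k (g \<otimes> x \<otimes> inv g) = k x" using k that by (simp add: H1G_def G_invariant_def)
    then show ?thesis using add[of "g \<otimes> x \<otimes> inv g" "inv x"] inv[of x] that
      by (simp add: mcomm_def conj_mem)
  qed
  obtain n where "comm_ball n z" using assms(2) comm_subgroup_iff by blast
  then show ?thesis
    by (induction rule: comm_ball.induct) (auto simp: one add gen inv dest: comm_ball_mem)
qed

end

section \<open>Comparison of \<open>scl\<close> over \<open>N\<close> and over
  \<open>L\<close>\<close>

lemma comm_subgroup_mono:
  assumes "N \<subseteq> L" shows "comm_subgroup G N \<subseteq> comm_subgroup G L"
proof
  have sub: "comm_gens G N \<subseteq> comm_gens G L" using assms by (auto simp: comm_gens_def)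
  fix z assume "z \<in> comm_subgroup G N"
  then show "z \<in> comm_subgroup G L"
    unfolding comm_subgroup_def
    by (induction rule: generate.induct) (use sub in \<open>auto intro: generate.intros\<close>)
qed

theorem theorem11p24:
  fixes G :: "('a, 'b) monoid_scheme" and L N :: "'a set"
    and l :: nat and \<nu> :: "nat \<Rightarrow> 'a \<Rightarrow> real"
  assumes "group G" and "L \<lhd> G" and "N \<lhd> G" and "N \<subseteq> L"
    and "l \<ge> 1"
    and "W_basis_reps G L N l \<nu>"
  defines "Z \<equiv> comm_subgroup G N \<inter> {z. \<forall>j<l. \<nu> j z = 0}"
  shows "(\<exists>C>0. \<forall>z\<in>Z. scl G N z \<le> C * scl G L z) \<and>
         (\<forall>C1 C2. C1 > 0 \<and> C2 > 0 \<and>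
            (\<forall>\<mu>\<in>QG G N. \<exists>k\<in>H1G G N. \<exists>\<psi>\<in>QG G L. \<exists>a::nat \<Rightarrow> real.
               (\<forall>x\<in>N. \<mu> x = k x + \<psi> x + (\<Sum>j<l. a j * \<nu> j x)) \<and>
               defect G N \<mu> \<ge> (1 / C1) * (defect G L \<psi> + (1 / C2) * (\<Sum>j<l. \<bar>a j\<bar>)))
          \<longrightarrow> (\<forall>z\<in>Z. scl G N z \<le> C1 * scl G L z))"
proof -
  interpret L: normal L G by fact
  interpret N: normal N G by fact
  obtain P where P: "sublin P" "\<And>v. P (- v) = P v"
    and P_stable_cl: "\<And>ws. N.admissible ws \<Longrightarrow> P (N.chain ws) = N.stable_cl ws"
    using N.stable_seminorm_exists by blast
  let ?e = "\<lambda>z. N.chain [(1, z)]"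
  have P_e: "P (?e z) = scl G N z" if "z \<in> Z" for z
    using that P_stable_cl N.admissible_singleton N.scl_eq_stable_cl by (simp add: Z_def)
  have Z_L: "z \<in> comm_subgroup G L" if "z \<in> Z" for z
    using that comm_subgroup_mono[OF assms(4)] by (auto simp: Z_def)
  \<comment> \<open>Membership in [G,N] kills \<open>k\<close> and the remaining conditions on
    \<open>Z\<close> kill every \<open>\<nu> j\<close>, so only the part that extends to
    \<open>L\<close> is left, and it can be measured by commutators over \<open>L\<close>.\<close>
  have Z_eval: "\<bar>\<mu> z\<bar> \<le> 2 * defect G L \<psi> * scl G L z"
    if z: "z \<in> Z" and k: "k \<in> H1G G N" and \<psi>: "\<psi> \<in> QG G L"
      and eq: "\<forall>x\<in>N. \<mu> x = k x + \<psi> x + (\<Sum>j<l. a j * \<nu> j x)" for z k \<psi> a and \<mu> :: "'a \<Rightarrow> real"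
  proof -
    have zN: "z \<in> comm_subgroup G N" "\<And>j. j < l \<Longrightarrow> \<nu> j z = 0" using z by (auto simp: Z_def)
    have "z \<in> N" using zN(1) N.comm_subgroup_iff N.comm_ball_mem by blast
    then have "\<mu> z = \<psi> z" using eq zN N.H1G_comm_subgroup[OF k zN(1)] by simp
    then show ?thesis using L.QG_le_scl[OF \<psi> Z_L[OF z]] by simp
  qed
  \<comment> \<open>For each \<open>f\<close> the bound is \<open>2 * defect G L \<psi>\<close>,
    which varies with \<open>f\<close> through \<open>\<psi>\<close>; uniformity in \<open>z\<close>
    for \<open>P\<close> itself comes from the gliding hump.\<close>
  have "\<exists>C>0. \<forall>z\<in>Z. P (?e z) \<le> C * scl G L z"
  proof (rule weakly_bounded_imp_bounded[of P, OF P])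
    show "0 \<le> scl G L z" if "z \<in> Z" for z using L.scl_nonneg Z_L that by blast
    fix f K assume f: "(0::real) \<le> K" "\<And>x y. f (x + y) = f x + f y" "\<And>x. \<bar>f x\<bar> \<le> K * P x"
    have "(\<lambda>x. f (?e x)) \<in> QG G N"
      by (rule N.functional_quasimorphism(1)[OF P_stable_cl f(2,3,1)])
    then obtain k \<psi> a where k: "k \<in> H1G G N" and \<psi>: "\<psi> \<in> QG G L"
      and eq: "\<forall>x\<in>N. f (?e x) = k x + \<psi> x + (\<Sum>j<l. a j * \<nu> j x)"
      using assms(6) unfolding W_basis_reps_def by meson
    then have "\<forall>z\<in>Z. \<bar>f (?e z)\<bar> \<le> 2 * defect G L \<psi> * scl G L z"
      using Z_eval[OF _ k \<psi> eq] by simp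
    then show "\<exists>B. \<forall>z\<in>Z. \<bar>f (?e z)\<bar> \<le> B * scl G L z" by blast
  qed
  moreover have "scl G N z \<le> C1 * scl G L z"
    if C: "C1 > 0" "C2 > 0" and dec: "\<forall>\<mu>\<in>QG G N. \<exists>k\<in>H1G G N. \<exists>\<psi>\<in>QG G L. \<exists>a::nat \<Rightarrow> real.
        (\<forall>x\<in>N. \<mu> x = k x + \<psi> x + (\<Sum>j<l. a j * \<nu> j x)) \<and>
        defect G N \<mu> \<ge> (1 / C1) * (defect G L \<psi> + (1 / C2) * (\<Sum>j<l. \<bar>a j\<bar>))" and z: "z \<in> Z"
    for C1 C2 z
  proof -
    obtain f where f: "\<And>x y. f (x + y) = f x + f y" "\<And>x. f x \<le> P x" "f (?e z) = P (?e z)"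
      using sublin_norming_additive[OF P(1), of "?e z"] by blast
    \<comment> \<open>Domination with \<open>K = 1\<close> turns the general defect bound
      \<open>K / 2\<close> into 1/2.\<close>
    have f_abs: "\<bar>f x\<bar> \<le> 1 * P x" for x
      using f(2)[of x] f(2)[of "- x"] additive_uminus[of f, OF f(1), of x] P(2)[of x] by linarith
    note qm = N.functional_quasimorphism[OF P_stable_cl f(1) f_abs zero_le_one]
    obtain k \<psi> a where k: "k \<in> H1G G N" and \<psi>: "\<psi> \<in> QG G L"
      and eq: "\<forall>x\<in>N. f (?e x) = k x + \<psi> x + (\<Sum>j<l. a j * \<nu> j x)"
      and D: "(1 / C1) * (defect G L \<psi> + (1 / C2) * (\<Sum>j<l. \<bar>a j\<bar>)) \<le> defect G N (\<lambda>x. f (?e x))"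
      using bspec[OF dec qm(1)] by blast
    have "(1 / C1) * (defect G L \<psi> + (1 / C2) * (\<Sum>j<l. \<bar>a j\<bar>)) \<le> 1 / 2"
      using D qm(2) by linarith
    then have "defect G L \<psi> + (1 / C2) * (\<Sum>j<l. \<bar>a j\<bar>) \<le> C1 / 2"
      using C(1) by (simp add: field_simps)
    moreover have "0 \<le> (1 / C2) * (\<Sum>j<l. \<bar>a j\<bar>)" using C(2) by (simp add: sum_nonneg)
    ultimately have "2 * defect G L \<psi> \<le> C1" by linarith
    then have "2 * defect G L \<psi> * scl G L z \<le> C1 * scl G L z"
      using L.scl_nonneg[OF Z_L[OF z]] by (rule mult_right_mono)
    then show ?thesis
      using Z_eval[OF z k \<psi> eq] f(3) P_e[OF z] by linarith
  qed
  ultimately show ?thesis using P_e by fastforce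
qed

end
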